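(* Let $F:\mathbb{R}^n\rightrightarrows\mathbb{R}^n$ be an upper semicontinuous set-valued map such that $F(x)$ is nonempty, compact and convex for every $x\in\mathbb{R}^n$, and let $\Sigma:\ \dot x\in F(x)$. Let $X_o,X_u\subset\mathbb{R}^n$ and let $B:\mathbb{R}^n\to\mathbb{R}$ be a barrier function candidate with respect to $(X_o,X_u)$, i.e. $B(x)>0$ for all $x\in X_u$ and $B(x)\le 0$ for all $x\in X_o$. Let $K:=\{x\in\mathbb{R}^n: B(x)\le 0\}$ and let $\partial K$ be its topological boundary. Then $\Sigma$ is robustly safe with respect to $(X_o,X_u)$ if at least one of the following conditions holds: (1) There exists a continuous function $\epsilon:\mathbb{R}^n\to\mathbb{R}_{>0}$ such that $K$ is forward invariant for $\Sigma_\epsilon:\ \dot x\in F(x)+\epsilon(x)\mathbb{B}$. (2) $B$ is locally Lipschitz and $\langle\zeta,\eta\rangle<0$ for all $x\in\partial K$, all $\eta\in F(x)$ and all $\zeta\in\partial_C B(x)$. (3) $B$ is continuously differentiable and $\langle\nabla B(x),\eta\rangle<0$ for all $x\in\partial K$ and all $\eta\in F(x)$.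
   Context: $|\cdot|$ is the Euclidean norm and $\mathbb{B}\subset\mathbb{R}^n$ is the closed unit ball centered at the origin. A set-valued map $F:\mathbb{R}^n\rightrightarrows\mathbb{R}^n$ is upper semicontinuous if for every $x$ and every $\varepsilon>0$ there is a neighborhood $U(x)$ of $x$ such that $F(y)\subset F(x)+\varepsilon\mathbb{B}$ for all $y\in U(x)$. Solutions: a solution to $\dot x\in G(x)$ starting from $x_o$ is a locally absolutely continuous map $\phi:\mathrm{dom}\,\phi\to\mathbb{R}^n$, where $\mathrm{dom}\,\phi=[0,T]$ with $T\in\mathbb{R}_{\ge0}$ or $\mathrm{dom}\,\phi=[0,T)$ with $T\in\mathbb{R}_{\ge0}\cup\{+\infty\}$, such that $\phi(0)=x_o$ and $\dot\phi(t)\in G(\phi(t))$ for almost all $t\in\mathrm{dom}\,\phi$. A set $K$ is forward invariant for a differential inclusion if every solution $\phi$ starting from $K$ satisfies $\phi(\mathrm{dom}\,\phi)\subset K$. A differential inclusion is safe with respect to $(X_o,X_u)$ if every solution $\phi$ starting from $X_o$ satisfies $\phi(\mathrm{dom}\,\phi)\subset\mathbb{R}^n\setminus X_u$. Robust safety: $\Sigma$ is robustly safe with respect to $(X_o,X_u)$ if there exists a continuous function $\epsilon:\mathbb{R}^n\to\mathbb{R}_{>0}$ such that $\Sigma_\epsilon:\ \dot x\in F(x)+\epsilon(x)\mathbb{B}$ is safe with respect to $(X_o,X_u)$. $B$ is locally Lipschitz if it is Lipschitz on every nonempty compact set. The Clarke generalized gradient of a locally Lipschitz $B$ at $x$ is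 $\partial_C B(x):=\mathrm{co}\{\lim_{i\to\infty}\nabla B(x_i): x_i\to x,\ x_i\notin\Omega\cup\Omega_B\}$, where $\mathrm{co}$ is the convex hull, $\Omega_B$ is the set of points where $B$ is not differentiable, and $\Omega$ is any set of Lebesgue measure zero (the result does not depend on the choice of $\Omega$). *)

theory Defs
  imports "HOL-Analysis.Analysis"
begin

definition set_plus_ball :: "'a::real_normed_vector set \<Rightarrow> real \<Rightarrow> 'a set"
    where
  "set_plus_ball A r = {a + r *\<^sub>R u | a u. a \<in> A \<and> u \<in> cball 0 1}"

definition upper_semicontinuous_map ::
    "('a::real_normed_vector \<Rightarrow> 'b::real_normed_vector set) \<Rightarrow> bool" where
  "upper_semicontinuous_map F \<longleftrightarrow>
     (\<forall>x. \<forall>e>0. \<exists>U. open U \<and> x \<in> U \<and> (\<forall>y\<in>U. F y \<subseteq> set_plus_ball (F x) e))"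

definition absolutely_continuous_on_interval ::
    "real \<Rightarrow> real \<Rightarrow> (real \<Rightarrow> 'a::real_normed_vector) \<Rightarrow> bool" where
  "absolutely_continuous_on_interval a b \<phi> \<longleftrightarrow>
     (\<forall>e>0. \<exists>d>0. \<forall>(m::nat) u v.
        (\<forall>i<m. a \<le> u i \<and> u i \<le> v i \<and> v i \<le> b) \<and>
        disjoint_family_on (\<lambda>i. {u i<..<v i}) {..<m} \<and>
        (\<Sum>i<m. v i - u i) < d \<longrightarrow>
        (\<Sum>i<m. norm (\<phi> (v i) - \<phi> (u i))) < e)"

definition locally_absolutely_continuous_on ::
    "real set \<Rightarrow> (real \<Rightarrow> 'a::real_normed_vector) \<Rightarrow> bool" where
  "locally_absolutely_continuous_on D \<phi> \<longleftrightarrow>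
     (\<forall>a b. a \<le> b \<and> {a..b} \<subseteq> D \<longrightarrow> absolutely_continuous_on_interval a b \<phi>)"

definition solution_domain :: "real set \<Rightarrow> bool" where
  "solution_domain D \<longleftrightarrow>
     (\<exists>T\<ge>0. D = {0..T}) \<or> (\<exists>T\<ge>0. D = {0..<T}) \<or> D = {0..}"

text \<open>A solution is a pair of a domain \<open>D\<close> and a total function \<open>\<phi>\<close>; apart from the initial
  value \<open>\<phi> 0\<close>, only the values of \<open>\<phi>\<close> on \<open>D\<close> matter. The domain \<open>{0..<0}\<close> is allowed and
  contributes no trajectory points.\<close>

definition di_solution ::
    "('a::real_normed_vector \<Rightarrow> 'a set) \<Rightarrow> 'a \<Rightarrow> real set \<Rightarrow> (real \<Rightarrow> 'a) \<Rightarrow> bool" where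
  "di_solution G x0 D \<phi> \<longleftrightarrow>
     solution_domain D \<and>
     locally_absolutely_continuous_on D \<phi> \<and>
     \<phi> 0 = x0 \<and>
     (AE t\<in>D in lebesgue.
        \<exists>w \<in> G (\<phi> t). (\<phi> has_vector_derivative w) (at t within D))"

definition forward_invariant ::
    "('a::real_normed_vector \<Rightarrow> 'a set) \<Rightarrow> 'a set \<Rightarrow> bool" where
  "forward_invariant G K \<longleftrightarrow>
     (\<forall>x0\<in>K. \<forall>D \<phi>. di_solution G x0 D \<phi> \<longrightarrow> \<phi> ` D \<subseteq> K)"

definition safe_wrt ::
    "('a::real_normed_vector \<Rightarrow> 'a set) \<Rightarrow> 'a set \<Rightarrow> 'a set \<Rightarrow> bool" where
  "safe_wrt G Xo Xu \<longleftrightarrow>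
     (\<forall>x0\<in>Xo. \<forall>D \<phi>. di_solution G x0 D \<phi> \<longrightarrow> \<phi> ` D \<subseteq> - Xu)"

definition perturbed ::
    "('a::real_normed_vector \<Rightarrow> 'a set) \<Rightarrow> ('a \<Rightarrow> real) \<Rightarrow> 'a \<Rightarrow> 'a set" where
  "perturbed F \<epsilon> = (\<lambda>x. set_plus_ball (F x) (\<epsilon> x))"

definition robustly_safe ::
    "('a::real_normed_vector \<Rightarrow> 'a set) \<Rightarrow> 'a set \<Rightarrow> 'a set \<Rightarrow> bool" where
  "robustly_safe F Xo Xu \<longleftrightarrow>
     (\<exists>\<epsilon>. continuous_on UNIV \<epsilon> \<and> (\<forall>x. \<epsilon> x > 0) \<and> safe_wrt (perturbed F \<epsilon>) Xo Xu)"

definition barrier_candidate :: "('a \<Rightarrow> real) \<Rightarrow> 'a set \<Rightarrow> 'a set \<Rightarrow> bool" where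
  "barrier_candidate B Xo Xu \<longleftrightarrow> (\<forall>x\<in>Xu. B x > 0) \<and> (\<forall>x\<in>Xo. B x \<le> 0)"

definition loc_lipschitz :: "('a::metric_space \<Rightarrow> 'b::metric_space) \<Rightarrow> bool" where
  "loc_lipschitz B \<longleftrightarrow>
     (\<forall>C. compact C \<and> C \<noteq> {} \<longrightarrow> (\<exists>L. L-lipschitz_on C B))"

text \<open>\<open>gradient f x\<close> is unspecified at points where \<open>f\<close> is not differentiable.\<close>

definition gradient :: "('a::real_inner \<Rightarrow> real) \<Rightarrow> 'a \<Rightarrow> 'a" where
  "gradient f x = (THE D. GDERIV f x :> D)"

lemma gradient_eqI:
  assumes "GDERIV f x :> D"
  shows "gradient f x = D"
proof -
  have "D' = D" if "GDERIV f x :> D'" for D'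
  proof -
    have "(\<lambda>h. inner h D') = (\<lambda>h. inner h D)"
      using assms that unfolding gderiv_def by (rule has_derivative_unique[rotated])
    then have "inner h D' = inner h D" for h
      by (rule fun_cong)
    then show ?thesis
      by (intro vector_eq_ldot[THEN iffD1]) blast
  qed
  with assms show ?thesis
    unfolding gradient_def by blast
qed

lemma GDERIV_gradient:
  fixes f :: "'a::euclidean_space \<Rightarrow> real"
  assumes "f differentiable (at x)"
  shows "GDERIV f x :> gradient f x"
proof -
  obtain f' where f': "(f has_derivative f') (at x)"
    using assms unfolding differentiable_def by blast
  interpret bounded_linear f'
    using f' by (rule has_derivative_bounded_linear)
  define D where "D = (\<Sum>b\<in>Basis. f' b *\<^sub>R b)"
  have "f' h = inner h D" for h
  proof -
    have "f' h = f' (\<Sum>b\<in>Basis. inner h b *\<^sub>R b)"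
      by (simp add: euclidean_representation)
    also have "\<dots> = inner h D"
      by (simp add: D_def sum scaleR inner_sum_right mult.commute)
    finally show ?thesis .
  qed
  then have "f' = (\<lambda>h. inner h D)"
    by blast
  with f' have "GDERIV f x :> D"
    by (simp add: gderiv_def)
  then show ?thesis
    using gradient_eqI by metis
qed

definition continuously_differentiable :: "('a::euclidean_space \<Rightarrow> real) \<Rightarrow> bool" where
  "continuously_differentiable f \<longleftrightarrow>
     (\<forall>x. f differentiable (at x)) \<and> continuous_on UNIV (gradient f)"

text \<open>The excluded set \<open>\<Omega>\<close> is kept as a parameter. It is meant to be an arbitrary Lebesgue null
  set; for locally Lipschitz \<open>f\<close> the result then does not depend on it.\<close>

definition clarke_gradient ::
    "'a::euclidean_space set \<Rightarrow> ('a \<Rightarrow> real) \<Rightarrow> 'a \<Rightarrow> 'a set" where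
  "clarke_gradient \<Omega> f x =
     convex hull {l. \<exists>s. s \<longlonglongrightarrow> x \<and>
       (\<forall>i. s i \<notin> \<Omega> \<union> {y. \<not> f differentiable (at y)}) \<and>
       (\<lambda>i. gradient f (s i)) \<longlonglongrightarrow> l}"

end

theory Submission
  imports Defs
begin

text \<open>
  Condition (3) is a case of (2): a \<open>C\<^sup>1\<close> function is locally Lipschitz and its Clarke gradient
  contains at most \<open>\<nabla>B x\<close>. Condition (2) implies (1). By compactness, every boundary point \<open>x\<close> of
  \<open>K\<close> has a radius \<open>r\<close> such that \<open>\<nabla>B z \<bullet> \<eta> \<le> 0\<close> for all \<open>\<eta>\<close> within \<open>r\<close> of \<open>F y\<close> and all
  \<open>y, z\<close> within \<open>r\<close> of \<open>x\<close>, with \<open>z \<notin> \<Omega>\<close> a point of differentiability; a fixed fraction of the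
  largest such radius is a Lipschitz perturbation bound. By Rademacher's theorem and Fubini's theorem
  along lines, the locally Lipschitz function \<open>B\<close> is nonincreasing near \<open>x\<close> along every admissible
  direction \<open>\<eta>\<close>. Hence the upper derivative of \<open>B \<circ> \<phi>\<close> is nonpositive almost everywhere as long as a
  solution \<open>\<phi>\<close> stays near \<open>x\<close>, and \<open>B \<circ> \<phi>\<close>, being absolutely continuous, cannot become positive
  after \<open>\<phi>\<close> reaches \<open>x\<close>.

  Rademacher's theorem rests on two measure arguments. A Lipschitz function on the line is
  differentiable almost everywhere by the Vitali covering theorem. Directional derivatives are
  additive almost everywhere because the points of a closed set that are isolated in it along a
  given direction form a null set.
\<close>

subsection \<open>Images under increasing functions and null sets along lines\<close>

text \<open>Vitali's theorem picks disjoint intervals of slope at most \<open>c\<close>, inside an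
  open set slightly larger than \<open>E\<close>, that cover \<open>E\<close> up to a null set.
  Their images are intervals at most \<open>c\<close> times as long, and the Lipschitz function
  \<open>h\<close> keeps the uncovered null set null. Continuity of the inverse \<open>k\<close>
  makes images of Borel sets Borel.\<close>

lemma emeasure_increasing_image_le:
  fixes h k :: "real \<Rightarrow> real"
  assumes mono: "strict_mono h" and L: "L-lipschitz_on UNIV h"
    and kh: "\<And>x. k (h x) = x" and hk: "\<And>x. h (k x) = x" and k: "continuous_on UNIV k"
    and E: "E \<in> sets borel" "bounded E" and c: "c \<ge> 0"
    and slope: "\<And>x d. x \<in> E \<Longrightarrow> d > 0 \<Longrightarrow> \<exists>u v. u < x \<and> x < v \<and> v - u < d \<and> h v - h u \<le> c * (v - u)"
  shows "emeasure lebesgue (h ` E) \<le> ennreal c * emeasure lebesgue E"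
proof -
  have cont: "continuous_on UNIV h"
    using L by (rule lipschitz_on_continuous_on)
  have img: "h ` S = k -` S" for S
    using kh hk by (auto simp: image_iff) (metis hk)
  have [measurable]: "k \<in> borel_measurable borel"
    using k by (rule borel_measurable_continuous_onI)
  have hborel: "h ` S \<in> sets borel" if "S \<in> sets borel" for S
    unfolding img using measurable_sets[OF _ that, of k borel] by simp
  have hIcc: "h ` {u..v} = {h u..h v}" for u v
  proof -
    have "h u \<le> y \<longleftrightarrow> u \<le> k y" "y \<le> h v \<longleftrightarrow> k y \<le> v" for y
      using mono hk by (metis strict_mono_less_eq)+
    then show ?thesis
      unfolding img by auto
  qed
  have inj: "inj h"
    using kh by (rule inj_on_inverseI)
  have Eleb: "E \<in> sets lebesgue" using E by auto
  have Efin: "emeasure lebesgue E < \<infinity>"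
    using fmeasurableD2[OF bounded_set_imp_lmeasurable[OF E(2) Eleb]] by (simp add: less_top)
  have *: "emeasure lebesgue (h ` E) \<le> ennreal c * (emeasure lebesgue E + ennreal e)" if e: "e > 0" for e
  proof -
    obtain T where T: "open T" "E \<subseteq> T" "emeasure lebesgue (T - E) < ennreal e" "T - E \<in> lmeasurable"
      using sets_lebesgue_outer_open[OF Eleb e] by metis
    \<comment> \<open>Intervals are coded as pairs of a midpoint and a radius, the form in which
      Vitali's theorem for balls takes them.\<close>
    define K where "K = {(m, r). 0 < r \<and> cball m r \<subseteq> T \<and> h (m + r) - h (m - r) \<le> c * (2 * r)}"
    have cov: "\<exists>i. i \<in> K \<and> x \<in> cball (fst i) (snd i) \<and> snd i < d" if x: "x \<in> E" and d: "d > 0" for x d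
    proof -
      obtain b where b: "b > 0" "ball x b \<subseteq> T"
        using T x by (meson openE subsetD)
      obtain u v where uv: "u < x" "x < v" "v - u < min b d" "h v - h u \<le> c * (v - u)"
        using slope[OF x, of "min b d"] b d by auto
      have cb: "cball ((u+v)/2) ((v-u)/2) = {u..v}"
        by (simp add: cball_eq_atLeastAtMost field_simps)
      have "{u..v} \<subseteq> ball x b"
        using uv by (auto simp: dist_real_def)
      moreover have "(u+v)/2 + (v-u)/2 = v" "(u+v)/2 - (v-u)/2 = u" "2 * ((v-u)/2) = v - u"
        by (simp_all add: field_simps)
      ultimately have "((u+v)/2, (v-u)/2) \<in> K"
        using uv b cb unfolding K_def by (simp only: mem_Collect_eq prod.case) auto
      moreover have "x \<in> cball ((u+v)/2) ((v-u)/2)" unfolding cb using uv by simp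
      moreover have "(v-u)/2 < d" using uv by (simp add: field_simps)
      ultimately show ?thesis
        by (intro exI[of _ "((u+v)/2, (v-u)/2)"]) auto
    qed
    have pos: "0 < snd i" if "i \<in> K" for i
      using that by (auto simp: K_def)
    obtain C where C: "countable C" "C \<subseteq> K"
       "pairwise (\<lambda>i j. disjnt (cball (fst i) (snd i)) (cball (fst j) (snd j))) C"
       and neg: "negligible (E - (\<Union>i\<in>C. cball (fst i) (snd i)))"
      by (rule Vitali_covering_theorem_cballs[OF pos cov])
    let ?I = "\<lambda>i::real\<times>real. cball (fst i) (snd i)"
    define Z where "Z = E - (\<Union>i\<in>C. ?I i)"
    have disj: "disjoint_family_on ?I C"
      using C(3) by (auto simp: disjoint_family_on_def pairwise_def disjnt_def)
    then have disj': "disjoint_family_on (\<lambda>i. h ` ?I i) C"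
      using inj by (force simp: disjoint_family_on_def inj_def)
    have "negligible (h ` Z)"
    proof (rule negligible_locally_Lipschitz_image)
      show "negligible Z" using neg by (simp add: Z_def)
      fix x show "\<exists>T B. open T \<and> x \<in> T \<and> (\<forall>y\<in>Z \<inter> T. norm (h y - h x) \<le> B * norm (y - x))"
        using L by (intro exI[of _ UNIV] exI[of _ L]) (auto simp: lipschitz_on_def dist_norm)
    qed auto
    then have hZ: "h ` Z \<in> null_sets lebesgue"
      by (simp add: negligible_iff_null_sets)
    have m1: "h ` ?I i \<in> sets lebesgue" "?I i \<in> sets lebesgue" for i
      using hborel[of "?I i"] by auto
    have "E \<subseteq> (\<Union>i\<in>C. ?I i) \<union> Z"
      by (auto simp: Z_def)
    then have sub: "h ` E \<subseteq> (\<Union>i\<in>C. h ` ?I i) \<union> h ` Z"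
      by (metis image_mono image_Un image_UN)
    have "emeasure lebesgue (h ` E) \<le> emeasure lebesgue ((\<Union>i\<in>C. h ` ?I i) \<union> h ` Z)"
      using m1 C(1) hZ by (intro emeasure_mono sub sets.Un sets.countable_UN') auto
    also have "\<dots> = emeasure lebesgue (\<Union>i\<in>C. h ` ?I i)"
      using m1 C(1) hZ by (intro emeasure_Un_null_set sets.countable_UN') auto
    also have "\<dots> = (\<integral>\<^sup>+i. emeasure lebesgue (h ` ?I i) \<partial>count_space C)"
      by (intro emeasure_UN_countable m1 C disj')
    also have "\<dots> \<le> (\<integral>\<^sup>+i. ennreal c * emeasure lebesgue (?I i) \<partial>count_space C)"
    proof (intro nn_integral_mono)
      fix i assume "i \<in> space (count_space C)"
      then have i: "0 < snd i" "h (fst i + snd i) - h (fst i - snd i) \<le> c * (2 * snd i)"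
        using C(2) by (auto simp: K_def)
      have "h (fst i - snd i) \<le> h (fst i + snd i)"
        using i mono by (simp add: strict_mono_less_eq)
      then have "emeasure lebesgue (h ` ?I i) = ennreal (h (fst i + snd i) - h (fst i - snd i))"
        unfolding cball_eq_atLeastAtMost hIcc by simp
      also have "\<dots> \<le> ennreal (c * (2 * snd i))"
        using i by (intro ennreal_leI)
      also have "\<dots> = ennreal c * emeasure lebesgue (?I i)"
        unfolding cball_eq_atLeastAtMost using i c by (simp add: ennreal_mult)
      finally show "emeasure lebesgue (h ` ?I i) \<le> ennreal c * emeasure lebesgue (?I i)" .
    qed
    also have "\<dots> = ennreal c * (\<integral>\<^sup>+i. emeasure lebesgue (?I i) \<partial>count_space C)"
      by (intro nn_integral_cmult) auto
    also have "(\<integral>\<^sup>+i. emeasure lebesgue (?I i) \<partial>count_space C) = emeasure lebesgue (\<Union>i\<in>C. ?I i)"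
      by (intro emeasure_UN_countable[symmetric] m1 C disj)
    also have "\<dots> \<le> emeasure lebesgue T"
      using C(2) T by (intro emeasure_mono) (force simp: K_def)+
    also have "emeasure lebesgue T = emeasure lebesgue (E \<union> (T - E))"
      using T by (simp add: Un_absorb1)
    also have "\<dots> \<le> emeasure lebesgue E + emeasure lebesgue (T - E)"
      using Eleb T by (intro emeasure_subadditive) auto
    also have "\<dots> \<le> emeasure lebesgue E + ennreal e"
      using T by (intro add_left_mono) auto
    finally show ?thesis by (simp add: mult_left_mono)
  qed
  obtain m where m: "m \<ge> 0" "emeasure lebesgue E = ennreal m"
    using Efin by (cases "emeasure lebesgue E") auto
  show ?thesis
  proof (rule ennreal_le_epsilon)
    fix e :: real assume e: "e > 0"
    \<comment> \<open>Dividing by \<open>c + 1\<close> rather than by \<open>c\<close> also covers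
      \<open>c = 0\<close>.\<close>
    have "emeasure lebesgue (h ` E) \<le> ennreal c * (ennreal m + ennreal (e / (c + 1)))"
      using *[of "e / (c + 1)"] e c m by simp
    also have "\<dots> = ennreal (c * m + c * (e / (c + 1)))"
      using m c e by (simp add: ennreal_mult'[symmetric] ennreal_plus[symmetric] distrib_left del: ennreal_plus)
    also have "\<dots> \<le> ennreal (c * m + e)"
      using c e by (intro ennreal_leI) (simp add: field_simps)
    also have "\<dots> = ennreal c * emeasure lebesgue E + ennreal e"
      using m c e by (simp add: ennreal_mult)
    finally show "emeasure lebesgue (h ` E) \<le> ennreal c * emeasure lebesgue E + ennreal e" .
  qed
qed

section \<open>Null sets and parallel lines\<close>

lemma AE_lborel_translate_iff:
  fixes c :: "'a::euclidean_space"
  assumes N: "N \<in> sets borel"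
  shows "(AE x in lborel. x + c \<notin> N) \<longleftrightarrow> (AE x in lborel. x \<notin> N)"
proof -
  have "(AE x in lborel. x \<notin> N) \<longleftrightarrow> (AE x in distr lborel borel ((+) c). x \<notin> N)"
    unfolding lborel_distr_plus ..
  also have "\<dots> \<longleftrightarrow> (AE x in lborel. c + x \<notin> N)"
    using N by (intro AE_distr_iff) auto
  finally show ?thesis by (simp add: add.commute)
qed

text \<open>Fubini's theorem on pairs \<open>(s, x)\<close>: for fixed \<open>s\<close> the
  condition on \<open>x\<close> concerns a translate of \<open>N\<close>, so it does not depend on
  \<open>s\<close>.\<close>

lemma AE_lborel_line_commute:
  fixes w :: "'a::euclidean_space"
  assumes N: "N \<in> sets borel"
  shows "(AE x in lborel. AE s in (lborel :: real measure). x + s *\<^sub>R w \<notin> N) \<longleftrightarrow> (AE x in lborel. x \<notin> N)"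
proof -
  let ?M = "(lborel :: real measure) \<Otimes>\<^sub>M (lborel :: 'a measure)"
  have meas: "(\<lambda>p. snd p + fst p *\<^sub>R w) \<in> borel_measurable ?M"
    by measurable
  have "- N \<in> sets borel"
    using N by (rule borel_comp)
  then have "(\<lambda>p. snd p + fst p *\<^sub>R w) -` (- N) \<inter> space ?M \<in> sets ?M"
    by (rule measurable_sets[OF meas])
  also have "(\<lambda>p. snd p + fst p *\<^sub>R w) -` (- N) \<inter> space ?M = {p \<in> space ?M. snd p + fst p *\<^sub>R w \<notin> N}"
    by blast
  finally have "{p \<in> space ?M. snd p + fst p *\<^sub>R w \<notin> N} \<in> sets ?M" .
  then have "(AE s in (lborel :: real measure). AE x in lborel. x + s *\<^sub>R w \<notin> N)
     \<longleftrightarrow> (AE x in lborel. AE s in (lborel :: real measure). x + s *\<^sub>R w \<notin> N)"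
    by (rule lborel_pair.AE_commute)
  moreover have "(AE s in (lborel :: real measure). AE x in lborel. x + s *\<^sub>R w \<notin> N)
     \<longleftrightarrow> (AE x in lborel. x \<notin> N)"
  proof -
    \<comment> \<open>The real line is not a null set, so its almost-everywhere filter is proper and
      a condition constant in \<open>s\<close> can be pulled out.\<close>
    have "ae_filter (lborel :: real measure) \<noteq> bot"
      by (simp add: ae_filter_eq_bot_iff)
    then show ?thesis
      unfolding AE_lborel_translate_iff[OF N] by (simp add: eventually_const)
  qed
  ultimately show ?thesis by blast
qed

subsection \<open>Oscillation of difference quotients and directional derivatives\<close>

text \<open>
  Only quotients over intervals that contain \<open>x\<close> in their interior are used: for continuous \<open>f\<close>
  this makes the set a \<open>G\<^sub>\<delta>\<close>, hence Borel.
\<close>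

definition oscillation_set :: "('a::real_normed_vector \<Rightarrow> real) \<Rightarrow> 'a \<Rightarrow> real \<Rightarrow> real \<Rightarrow> 'a set" where
  "oscillation_set f w p q = {x. \<forall>d>0.
     (\<exists>u<0. \<exists>v>0. v - u < d \<and> f (x + v *\<^sub>R w) - f (x + u *\<^sub>R w) < p * (v - u)) \<and>
     (\<exists>u<0. \<exists>v>0. v - u < d \<and> f (x + v *\<^sub>R w) - f (x + u *\<^sub>R w) > q * (v - u))}"

lemma oscillation_set_borel:
  fixes f :: "'a::euclidean_space \<Rightarrow> real"
  assumes f: "continuous_on UNIV f"
  shows "oscillation_set f w p q \<in> sets borel"
proof -
  define A where "A d = {x. \<exists>u<0. \<exists>v>0. v - u < d \<and> f (x + v *\<^sub>R w) - f (x + u *\<^sub>R w) < p * (v - u)}" for d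
  define C where "C d = {x. \<exists>u<0. \<exists>v>0. v - u < d \<and> f (x + v *\<^sub>R w) - f (x + u *\<^sub>R w) > q * (v - u)}" for d
  have cont: "continuous_on UNIV (\<lambda>x. f (x + a))" for a
    by (intro continuous_on_compose2[OF f] continuous_intros) auto
  have "A d = (\<Union>u\<in>{..<0}. \<Union>v\<in>{v. 0 < v \<and> v - u < d}. {x. f (x + v *\<^sub>R w) - f (x + u *\<^sub>R w) < p * (v - u)})" for d
    by (auto simp: A_def)
  moreover have "C d = (\<Union>u\<in>{..<0}. \<Union>v\<in>{v. 0 < v \<and> v - u < d}. {x. q * (v - u) < f (x + v *\<^sub>R w) - f (x + u *\<^sub>R w)})" for d
    by (auto simp: C_def)
  ultimately have op: "open (A d)" "open (C d)" for d
    by (auto intro!: open_UN open_Collect_less continuous_on_diff cont continuous_intros)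
  have anti: "A d \<subseteq> A e" "C d \<subseteq> C e" if "d \<le> e" for d e
    using that unfolding A_def C_def by (blast intro: less_le_trans)+
  \<comment> \<open>\<open>A d\<close> and \<open>C d\<close> are open and shrink with
    \<open>d\<close>, so the scales \<open>1 / (n + 1)\<close> suffice and a countable intersection
    of open sets remains.\<close>
  have "oscillation_set f w p q = (\<Inter>n. A (1 / real (Suc n)) \<inter> C (1 / real (Suc n)))"
  proof (intro subset_antisym subsetI)
    fix x assume x: "x \<in> (\<Inter>n. A (1 / real (Suc n)) \<inter> C (1 / real (Suc n)))"
    have "x \<in> A d \<inter> C d" if "d > 0" for d
    proof -
      obtain n where n: "1 / real (Suc n) < d"
        using \<open>d > 0\<close> by (rule nat_approx_posE)
      have "x \<in> A (1 / real (Suc n)) \<inter> C (1 / real (Suc n))"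
        using x by (rule INT_D) simp
      with anti[OF less_imp_le[OF n]] show ?thesis by auto
    qed
    then show "x \<in> oscillation_set f w p q"
      by (simp add: oscillation_set_def A_def C_def)
  next
    fix x assume x: "x \<in> oscillation_set f w p q"
    have "x \<in> A d \<inter> C d" if "d > 0" for d
      using x that unfolding oscillation_set_def A_def C_def by blast
    then show "x \<in> (\<Inter>n. A (1 / real (Suc n)) \<inter> C (1 / real (Suc n)))"
      by simp
  qed
  then show ?thesis
    using op by simp
qed

lemma line_vimage_oscillation_set:
  "{s. x + s *\<^sub>R w \<in> oscillation_set f w p q} = oscillation_set (\<lambda>s. f (x + s *\<^sub>R w)) 1 p q"
  by (simp add: oscillation_set_def algebra_simps)

text \<open>
  Shearing a Lipschitz function makes it bi-Lipschitz, so that images of null sets are null in both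
  directions.
\<close>

lemma lipschitz_shear_inverse:
  fixes g :: "real \<Rightarrow> real"
  assumes g: "L-lipschitz_on UNIV g"
  defines "h \<equiv> \<lambda>t. g t + (L + 1) * t"
  obtains k where "\<And>x. k (h x) = x" "\<And>x. h (k x) = x" "1-lipschitz_on UNIV k"
proof -
  \<comment> \<open>Slopes of \<open>g\<close> are at least \<open>- L\<close>, so those of
    \<open>h\<close> are at least 1: \<open>h\<close> is injective, attains every value by the
    intermediate value theorem, and has a 1-Lipschitz inverse.\<close>
  have step: "h t - h s \<ge> t - s" if "s \<le> t" for s t
  proof -
    have "\<bar>g t - g s\<bar> \<le> L * \<bar>t - s\<bar>"
      using lipschitz_onD[OF g, of t s] by (simp add: dist_real_def)
    then show ?thesis using that by (auto simp: h_def algebra_simps abs_if split: if_splits)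
  qed
  have cont: "continuous_on S h" for S
    unfolding h_def using lipschitz_on_continuous_on[OF g]
    by (intro continuous_intros) (auto elim: continuous_on_subset)
  have surj: "\<exists>x. h x = y" for y
  proof -
    let ?T = "\<bar>y - h 0\<bar>"
    have "h (- ?T) \<le> y" "y \<le> h ?T"
      using step[of "- ?T" 0] step[of 0 ?T] by auto
    then show ?thesis
      using IVT'[of h "- ?T" y ?T] cont by auto
  qed
  have inj: "x = y" if "h x = h y" for x y
    using step[of x y] step[of y x] that by linarith
  define k where "k = inv h"
  have hk: "h (k x) = x" for x
    unfolding k_def using surj by (intro f_inv_into_f) (auto simp: image_iff intro: sym dest: spec)
  have kh: "k (h x) = x" for x
    using hk inj by blast
  have "dist (k y) (k z) \<le> 1 * dist y z" for y z
    using step[of "k y" "k z"] step[of "k z" "k y"] hk by (auto simp: dist_real_def abs_if)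
  then have "1-lipschitz_on UNIV k"
    by (intro lipschitz_onI) auto
  with hk kh show ?thesis by (intro that[of k])
qed

text \<open>After a shear, the shallow intervals bound the image of a bounded piece of the set from
  above, and the steep ones, read through the inverse function, bound it from below. Both bounds can
  hold only if the piece is null.\<close>

lemma oscillation_set_null_real:
  fixes g :: "real \<Rightarrow> real"
  assumes g: "L-lipschitz_on UNIV g" and pq: "p < q"
  shows "oscillation_set g 1 p q \<in> null_sets lborel"
proof -
  define h where "h = (\<lambda>t. g t + (L + 1) * t)"
  obtain k where kh: "\<And>x. k (h x) = x" and hk: "\<And>x. h (k x) = x" and k: "1-lipschitz_on UNIV k"
    using lipschitz_shear_inverse[OF g] unfolding h_def by metis
  have L: "L \<ge> 0" using g by (rule lipschitz_on_nonneg)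
  have step: "t - s \<le> h t - h s \<and> h t - h s \<le> (2 * L + 1) * (t - s)" if "s \<le> t" for s t
  proof -
    have "\<bar>g t - g s\<bar> \<le> L * \<bar>t - s\<bar>"
      using lipschitz_onD[OF g, of t s] by (simp add: dist_real_def)
    then show ?thesis using that by (auto simp: h_def algebra_simps abs_if split: if_splits)
  qed
  have mono: "strict_mono h"
  proof (rule strict_monoI)
    fix s t :: real assume "s < t" then show "h s < h t" using step[of s t] by linarith
  qed
  have k_mono: "strict_mono k"
    by (rule strict_monoI) (metis hk mono strict_mono_less)
  have h_lip: "(2 * L + 1)-lipschitz_on UNIV h"
  proof (rule lipschitz_onI)
    fix s t show "dist (h s) (h t) \<le> (2 * L + 1) * dist s t"
      using step[of s t] step[of t s] by (cases "s \<le> t") (auto simp: dist_real_def)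
  qed (use L in simp)
  have cont: "continuous_on UNIV h" "continuous_on UNIV k"
    using h_lip k by (auto dest: lipschitz_on_continuous_on)
  \<comment> \<open>The shear adds \<open>L + 1\<close> to every slope, so the thresholds move
    along.\<close>
  define P Q where "P = p + L + 1" and "Q = q + L + 1"
  let ?E = "oscillation_set g 1 p q"
  have E: "?E \<in> sets borel"
    by (rule oscillation_set_borel[OF lipschitz_on_continuous_on[OF g]])
  have low: "\<exists>u v. u < x \<and> x < v \<and> v - u < d \<and> h v - h u < P * (v - u)"
    and high: "\<exists>u v. u < x \<and> x < v \<and> v - u < d \<and> h v - h u > Q * (v - u)"
    if x: "x \<in> ?E" and d: "d > 0" for x d
  proof -
    from x d obtain u v where "u < 0" "0 < v" "v - u < d" "g (x + v) - g (x + u) < p * (v - u)"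
      by (auto simp: oscillation_set_def)
    then show "\<exists>u v. u < x \<and> x < v \<and> v - u < d \<and> h v - h u < P * (v - u)"
      by (intro exI[of _ "x + u"] exI[of _ "x + v"]) (auto simp: h_def P_def algebra_simps)
    from x d obtain u v where "u < 0" "0 < v" "v - u < d" "g (x + v) - g (x + u) > q * (v - u)"
      by (auto simp: oscillation_set_def)
    then show "\<exists>u v. u < x \<and> x < v \<and> v - u < d \<and> h v - h u > Q * (v - u)"
      by (intro exI[of _ "x + u"] exI[of _ "x + v"]) (auto simp: h_def Q_def algebra_simps)
  qed
  \<comment> \<open>Bounded pieces have finite measure, which allows the final comparison to be made
    in the reals.\<close>
  have null: "?E \<inter> {- real n..real n} \<in> null_sets lborel" for n
  proof (cases "?E = {}")
    case False
    then obtain u v where "u < v" "h v - h u < P * (v - u)"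
      using low[OF _ zero_less_one] by (meson all_not_in_conv less_trans)
    \<comment> \<open>Slopes of \<open>h\<close> are at least 1, so a single shallow interval
      already forces \<open>P > 1\<close>; this makes \<open>Q\<close> positive.\<close>
    with step[of u v] \<open>u < v\<close> have "1 * (v - u) < P * (v - u)"
      by (smt (verit))
    with \<open>u < v\<close> have P: "1 < P"
      by (metis diff_gt_0_iff_gt mult_less_cancel_right_pos)
    then have PQ: "P < Q" using pq by (simp add: P_def Q_def)
    let ?S = "?E \<inter> {- real n..real n}"
    have S: "?S \<in> sets borel" "bounded ?S"
      using E by (auto intro: bounded_Int)
    have 1: "emeasure lebesgue (h ` ?S) \<le> ennreal P * emeasure lebesgue ?S"
    proof (rule emeasure_increasing_image_le[OF mono h_lip kh hk cont(2) S])
      fix x d :: real assume "x \<in> ?S" "d > 0"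
      then show "\<exists>u v. u < x \<and> x < v \<and> v - u < d \<and> h v - h u \<le> P * (v - u)"
        using low[of x d] by (auto intro: less_imp_le)
    qed (use P in simp)
    have "h ` A = k -` A" for A
      using kh hk by (auto simp: image_iff) (metis hk)
    then have "h ` ?S = k -` ?S" .
    moreover have "k -` ?S \<inter> space borel \<in> sets borel"
      using borel_measurable_continuous_onI[OF cont(2)] S(1) by (rule measurable_sets)
    ultimately have hS: "h ` ?S \<in> sets borel" by simp
    have bhS: "bounded (h ` ?S)"
    proof (rule bounded_subset)
      show "bounded (h ` {- real n..real n})"
        by (intro compact_imp_bounded compact_continuous_image continuous_on_subset[OF cont(1)]) auto
    qed auto
    \<comment> \<open>The two bounds give \<open>Q * |S| \<le> |h ` S| \<le> P * |S|\<close>, although \<open>P < Q\<close>.\<close>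
    have 2: "emeasure lebesgue (k ` h ` ?S) \<le> ennreal (1 / Q) * emeasure lebesgue (h ` ?S)"
    proof (rule emeasure_increasing_image_le[OF k_mono k hk kh cont(1) hS bhS])
      fix y d :: real assume "y \<in> h ` ?S" and d: "d > 0"
      then obtain x where x: "x \<in> ?E" "y = h x" by auto
      \<comment> \<open>\<open>h\<close> stretches lengths by at most \<open>2 * L + 1\<close>, so
        images of intervals shorter than this are shorter than \<open>d\<close>.\<close>
      have "d / (2 * L + 1) > 0" using d L by simp
      from high[OF x(1) this] obtain u v where uv: "u < x" "x < v" "v - u < d / (2 * L + 1)"
        "h v - h u > Q * (v - u)" by blast
      have "h v - h u \<le> (2 * L + 1) * (v - u)"
        using step[of u v] uv by simp
      also have "\<dots> < d" using uv L by (simp add: field_simps)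
      finally have "h v - h u < d" .
      moreover have "v - u \<le> 1 / Q * (h v - h u)"
        using uv P PQ by (simp add: field_simps)
      ultimately show "\<exists>u v. u < y \<and> y < v \<and> v - u < d \<and> k v - k u \<le> 1 / Q * (v - u)"
        using uv x mono kh by (intro exI[of _ "h u"] exI[of _ "h v"]) (auto simp: strict_mono_less)
    qed (use P PQ in simp)
    have "k ` h ` ?S = ?S"
      by (simp add: image_image kh)
    with 2 have "emeasure lebesgue ?S \<le> ennreal (1 / Q) * emeasure lebesgue (h ` ?S)" by simp
    also have "\<dots> \<le> ennreal (1 / Q) * (ennreal P * emeasure lebesgue ?S)"
      using 1 by (rule mult_left_mono) simp
    also have "\<dots> = ennreal (P / Q) * emeasure lebesgue ?S"
      using P PQ by (simp add: mult.assoc[symmetric] ennreal_mult'[symmetric])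
    finally have le: "emeasure lebesgue ?S \<le> ennreal (P / Q) * emeasure lebesgue ?S" .
    have "?S \<in> lmeasurable"
      using S by (intro bounded_set_imp_lmeasurable) auto
    then obtain m where m: "m \<ge> 0" "emeasure lebesgue ?S = ennreal m"
      using emeasure_eq_measure2 measure_nonneg by blast
    have "m \<le> P / Q * m"
      using le P PQ m by (simp add: ennreal_mult'[symmetric])
    then have "m * (1 - P / Q) \<le> 0" by (simp add: algebra_simps)
    moreover have "0 < 1 - P / Q" using P PQ by simp
    ultimately have "m \<le> 0"
      by (simp add: mult_le_0_iff)
    with m have "emeasure lborel ?S = 0"
      using S(1) by simp
    then show ?thesis using S(1) by auto
  qed simp
  have "?E = (\<Union>n. ?E \<inter> {- real n..real n})"
  proof (intro subset_antisym subsetI)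
    fix x assume "x \<in> ?E"
    moreover obtain n where "\<bar>x\<bar> \<le> real n" using real_arch_simple by blast
    ultimately show "x \<in> (\<Union>n. ?E \<inter> {- real n..real n})"
      by (auto simp: abs_le_iff intro!: exI[of _ n])
  qed auto
  then show ?thesis
    using null null_sets_UN[of "\<lambda>n. ?E \<inter> {- real n..real n}"] by (metis (no_types, lifting))
qed

lemma lipschitz_on_line:
  fixes f :: "'a::real_normed_vector \<Rightarrow> 'b::metric_space"
  assumes f: "L-lipschitz_on UNIV f"
  shows "(L * norm w)-lipschitz_on UNIV (\<lambda>s. f (x + s *\<^sub>R w))"
proof (rule lipschitz_onI)
  fix s t :: real
  have "dist (f (x + s *\<^sub>R w)) (f (x + t *\<^sub>R w)) \<le> L * dist (x + s *\<^sub>R w) (x + t *\<^sub>R w)"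
    using f by (rule lipschitz_onD) auto
  also have "dist (x + s *\<^sub>R w) (x + t *\<^sub>R w) = norm w * dist s t"
    by (simp add: dist_norm scaleR_left_diff_distrib[symmetric])
  finally show "dist (f (x + s *\<^sub>R w)) (f (x + t *\<^sub>R w)) \<le> L * norm w * dist s t"
    by (simp add: mult.assoc)
qed (use lipschitz_on_nonneg[OF f] in simp)

text \<open>The one-dimensional case makes the parameters of bad points null on every line in
  direction \<open>w\<close>; Fubini's theorem assembles the lines.\<close>

lemma AE_not_in_oscillation_set:
  fixes f :: "'a::euclidean_space \<Rightarrow> real"
  assumes f: "L-lipschitz_on UNIV f" and pq: "p < q"
  shows "AE x in lborel. x \<notin> oscillation_set f w p q"
proof -
  have "AE s in lborel. x + s *\<^sub>R w \<notin> oscillation_set f w p q" for x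
  proof -
    have "{s. x + s *\<^sub>R w \<in> oscillation_set f w p q} \<in> null_sets lborel"
      unfolding line_vimage_oscillation_set
      by (rule oscillation_set_null_real[OF lipschitz_on_line[OF f] pq])
    from AE_not_in[OF this] show ?thesis by simp
  qed
  then show ?thesis
    using AE_lborel_line_commute[OF oscillation_set_borel[OF lipschitz_on_continuous_on[OF f]]]
    by blast
qed

text \<open>The derivative is the supremum \<open>D\<close> of the rational lower slopes, those that
  bound the difference quotients of all short intervals around 0 from below. A rational just above
  \<open>D\<close> is undercut at every scale, so without oscillation a slightly larger one is not
  exceeded at small scales.\<close>

lemma has_derivative_if_no_oscillation:
  fixes g :: "real \<Rightarrow> real"
  assumes g: "L-lipschitz_on UNIV g"
    and no_osc: "\<And>p q. p \<in> \<rat> \<Longrightarrow> q \<in> \<rat> \<Longrightarrow> p < q \<Longrightarrow> 0 \<notin> oscillation_set g 1 p q"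
  shows "\<exists>D. (g has_real_derivative D) (at 0)"
proof -
  define P where "P = {p \<in> \<rat>. \<exists>d>0. \<forall>u<0. \<forall>v>0. v - u < d \<longrightarrow> p * (v - u) \<le> g v - g u}"
  have lip: "\<bar>g v - g u\<bar> \<le> L * (v - u)" if "u < v" for u v
    using lipschitz_onD[OF g, of u v] that by (simp add: dist_real_def abs_minus_commute)
  have ub: "p \<le> L" if p: "p \<in> P" for p
  proof -
    obtain d where d: "d > 0" "\<And>u v. u < 0 \<Longrightarrow> v > 0 \<Longrightarrow> v - u < d \<Longrightarrow> p * (v - u) \<le> g v - g u"
      using p by (auto simp: P_def)
    have "p * (d/4 - - (d/4)) \<le> L * (d/4 - - (d/4))"
      using order_trans[OF d(2)[of "-(d/4)" "d/4"] order_trans[OF abs_ge_self lip[of "-(d/4)" "d/4"]]] d(1)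
      by simp
    then show ?thesis using d(1) by (simp only: mult_le_cancel_right)
  qed
  \<comment> \<open>A rational below \<open>- L\<close> is a lower slope of all intervals, which
    makes \<open>P\<close> nonempty.\<close>
  obtain p0 where p0: "p0 \<in> \<rat>" "p0 < - L"
    using Rats_dense_in_real[of "- L - 1" "- L"] by auto
  have "p0 * (v - u) \<le> g v - g u" if "u < 0" "v > 0" for u v
  proof -
    have "p0 * (v - u) \<le> - L * (v - u)"
      using p0 that by (intro mult_right_mono) auto
    then show ?thesis using lip[of u v] that by auto
  qed
  then have "p0 \<in> P"
    using p0 by (auto simp: P_def intro!: exI[of _ 1])
  then have P: "P \<noteq> {}" "bdd_above P"
    using ub by (auto intro: bdd_aboveI[of P L])
  define D where "D = Sup P"
  have cont: "continuous_on UNIV g"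
    using g by (rule lipschitz_on_continuous_on)
  have main: "\<exists>d>0. \<forall>u\<le>0. \<forall>v\<ge>0. u < v \<longrightarrow> v - u < d \<longrightarrow> \<bar>g v - g u - D * (v - u)\<bar> \<le> e * (v - u)"
    if e: "e > 0" for e
  proof -
    obtain p where p: "p \<in> P" "D - e < p"
      using less_cSup_iff[OF P, of "D - e"] e by (auto simp: D_def)
    then obtain d1 where d1: "d1 > 0" "\<And>u v. u < 0 \<Longrightarrow> v > 0 \<Longrightarrow> v - u < d1 \<Longrightarrow> p * (v - u) \<le> g v - g u"
      by (auto simp: P_def)
    obtain q1 where q1: "q1 \<in> \<rat>" "D < q1" "q1 < D + e"
      using Rats_dense_in_real[of D "D + e"] e by auto
    obtain q2 where q2: "q2 \<in> \<rat>" "q1 < q2" "q2 < D + e"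
      using Rats_dense_in_real[of q1 "D + e"] q1 by auto
    have "q1 \<notin> P"
      using q1 P(2) cSup_upper[of q1 P] by (auto simp: D_def)
    then have notP: "\<exists>u<0. \<exists>v>0. v - u < d \<and> g v - g u < q1 * (v - u)" if "d > 0" for d
      using that q1 by (auto simp: P_def not_le)
    obtain d2 where d20: "d2 > 0" and "\<not> (\<exists>u<0. \<exists>v>0. v - u < d2 \<and> g v - g u > q2 * (v - u))"
      using no_osc[OF q1(1) q2(1,2)] notP by (auto simp: oscillation_set_def)
    then have d2: "g v - g u \<le> q2 * (v - u)" if "u < 0" "v > 0" "v - u < d2" for u v
      using that by (meson not_le)
    define d where "d = min d1 d2"
    have d: "d > 0" using d1 d20 by (simp add: d_def)
    have strict: "\<bar>g v - g u - D * (v - u)\<bar> \<le> e * (v - u)" if uv: "u < 0" "v > 0" "v - u < d" for u v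
    proof -
      have "p * (v - u) \<le> g v - g u" "g v - g u \<le> q2 * (v - u)"
        using d1(2) d2 uv by (auto simp: d_def)
      moreover have "(D - e) * (v - u) \<le> p * (v - u)" "q2 * (v - u) \<le> (D + e) * (v - u)"
        using p q2 uv by (auto intro!: mult_right_mono)
      ultimately show ?thesis by (auto simp: abs_le_iff algebra_simps)
    qed
    \<comment> \<open>\<open>strict\<close> concerns intervals with 0 in their interior. By
      continuity of \<open>g\<close>, moving one endpoint to 0 gives the quotients based at
      0.\<close>
    have left: "\<bar>g v - g 0 - D * (v - 0)\<bar> \<le> e * (v - 0)" if v: "0 < v" "v < d" for v
    proof (rule tendsto_le[of "at_left (0::real)"])
      have "eventually (\<lambda>u. u \<in> {v - d<..<0}) (at_left (0::real))"
        using v by (intro eventually_at_leftI[of "v - d"]) auto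
      then show "\<forall>\<^sub>F u in at_left 0. \<bar>g v - g u - D * (v - u)\<bar> \<le> e * (v - u)"
        by eventually_elim (use v strict in auto)
      have "(g \<longlongrightarrow> g 0) (at_left 0)"
        using cont by (metis UNIV_I continuous_on_def tendsto_within_subset top_greatest)
      then show "((\<lambda>u. \<bar>g v - g u - D * (v - u)\<bar>) \<longlongrightarrow> \<bar>g v - g 0 - D * (v - 0)\<bar>) (at_left 0)"
        by (intro tendsto_intros)
      show "((\<lambda>u. e * (v - u)) \<longlongrightarrow> e * (v - 0)) (at_left 0)"
        by (intro tendsto_intros)
    qed simp
    have right: "\<bar>g 0 - g u - D * (0 - u)\<bar> \<le> e * (0 - u)" if u: "u < 0" "- u < d" for u
    proof (rule tendsto_le[of "at_right (0::real)"])
      have "eventually (\<lambda>v. v \<in> {0<..<d + u}) (at_right (0::real))"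
        using u by (intro eventually_at_rightI[of _ "d + u"]) auto
      then show "\<forall>\<^sub>F v in at_right 0. \<bar>g v - g u - D * (v - u)\<bar> \<le> e * (v - u)"
        by eventually_elim (use u strict in auto)
      have "(g \<longlongrightarrow> g 0) (at_right 0)"
        using cont by (metis UNIV_I continuous_on_def tendsto_within_subset top_greatest)
      then show "((\<lambda>v. \<bar>g v - g u - D * (v - u)\<bar>) \<longlongrightarrow> \<bar>g 0 - g u - D * (0 - u)\<bar>) (at_right 0)"
        by (intro tendsto_intros)
      show "((\<lambda>v. e * (v - u)) \<longlongrightarrow> e * (0 - u)) (at_right 0)"
        by (intro tendsto_intros)
    qed simp
    show ?thesis
    proof (intro exI[of _ d] conjI allI impI d)
      fix u v :: real assume "u \<le> 0" "v \<ge> 0" "u < v" "v - u < d"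
      then show "\<bar>g v - g u - D * (v - u)\<bar> \<le> e * (v - u)"
        using strict[of u v] left[of v] right[of u] by (cases "u = 0"; cases "v = 0") auto
    qed
  qed
  have "(g has_real_derivative D) (at 0)"
    unfolding DERIV_def LIM_eq
  proof (intro allI impI)
    fix r :: real assume r: "r > 0"
    obtain d where d: "d > 0" "\<And>u v. u \<le> 0 \<Longrightarrow> v \<ge> 0 \<Longrightarrow> u < v \<Longrightarrow> v - u < d \<Longrightarrow> \<bar>g v - g u - D * (v - u)\<bar> \<le> r/2 * (v - u)"
      using main[of "r/2"] r by auto
    show "\<exists>s>0. \<forall>x. x \<noteq> 0 \<and> norm (x - 0) < s \<longrightarrow> norm ((g (0 + x) - g 0) / x - D) < r"
    proof (intro exI[of _ d] conjI allI impI d)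
      fix x :: real assume x: "x \<noteq> 0 \<and> norm (x - 0) < d"
      have "\<bar>g x - g 0 - D * x\<bar> \<le> r/2 * \<bar>x\<bar>"
        using d(2)[of 0 x] d(2)[of x 0] x by (cases "x > 0") (auto simp: abs_if split: if_splits)
      moreover have "(g x - g 0) / x - D = (g x - g 0 - D * x) / x"
        using x by (simp add: field_simps)
      ultimately have "\<bar>(g x - g 0) / x - D\<bar> \<le> r/2"
        using x by (simp add: abs_divide pos_divide_le_eq)
      then show "norm ((g (0 + x) - g 0) / x - D) < r"
        using r by simp
    qed
  qed
  then show ?thesis ..
qed

lemma AE_directional_derivative:
  fixes f :: "'a::euclidean_space \<Rightarrow> real"
  assumes f: "L-lipschitz_on UNIV f"
  shows "AE x in lborel. \<exists>D. ((\<lambda>t. f (x + t *\<^sub>R w)) has_real_derivative D) (at 0)"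
proof -
  have "AE x in lborel. \<forall>p\<in>\<rat>. \<forall>q\<in>\<rat>. p < q \<longrightarrow> x \<notin> oscillation_set f w p q"
    using AE_not_in_oscillation_set[OF f]
    by (auto simp: AE_ball_countable countable_rat)
  then show ?thesis
  proof eventually_elim
    fix x assume x: "\<forall>p\<in>\<rat>. \<forall>q\<in>\<rat>. p < q \<longrightarrow> x \<notin> oscillation_set f w p q"
    show "\<exists>D. ((\<lambda>t. f (x + t *\<^sub>R w)) has_real_derivative D) (at 0)"
    proof (rule has_derivative_if_no_oscillation[OF lipschitz_on_line[OF f]])
      fix p q :: real assume "p \<in> \<rat>" "q \<in> \<rat>" "p < q"
      with x have "0 \<notin> {s. x + s *\<^sub>R w \<in> oscillation_set f w p q}" by simp
      then show "0 \<notin> oscillation_set (\<lambda>s. f (x + s *\<^sub>R w)) 1 p q"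
        unfolding line_vimage_oscillation_set .
    qed
  qed
qed

subsection \<open>Rademacher's theorem\<close>

text \<open>The exceptional set \<open>I\<close> meets every line in direction \<open>u\<close> in
  parameters more than \<open>r\<close> apart, hence in a countable set; Fubini's theorem makes
  \<open>I\<close> null.\<close>

lemma AE_not_isolated_on_line:
  fixes A :: "'a::euclidean_space set"
  assumes A: "closed A" and r: "r > 0"
  shows "AE x in lborel. x \<in> A \<longrightarrow> (\<exists>t. 0 < \<bar>t\<bar> \<and> \<bar>t\<bar> \<le> r \<and> x + t *\<^sub>R u \<in> A)"
proof -
  \<comment> \<open>Bounding \<open>\<bar>t\<bar>\<close> away from 0 gives compact sets
    \<open>T n\<close>, so that each \<open>H n\<close> is closed and \<open>I\<close> is
    Borel.\<close>
  define T where "T n = {t::real. 1 / real (Suc n) \<le> \<bar>t\<bar> \<and> \<bar>t\<bar> \<le> r}" for n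
  define H where "H n = {x. \<exists>t\<in>T n. x + t *\<^sub>R u \<in> A}" for n
  define I where "I = A - (\<Union>n. H n)"
  have T: "compact (T n)" for n
  proof -
    have "T n = {- r..r} \<inter> {t. 1 / real (Suc n) \<le> \<bar>t\<bar>}"
      by (auto simp: T_def)
    moreover have "closed {t::real. 1 / real (Suc n) \<le> \<bar>t\<bar>}"
      by (intro closed_Collect_le continuous_intros)
    ultimately show ?thesis
      by (metis compact_Icc compact_Int_closed)
  qed
  have "closed (H n)" for n
  proof -
    have "compact ((\<lambda>t. - (t *\<^sub>R u)) ` T n)"
      by (intro compact_continuous_image T continuous_intros)
    then have "closed (\<Union>x\<in>A. \<Union>y\<in>(\<lambda>t. - (t *\<^sub>R u)) ` T n. {x + y})"
      by (rule closed_compact_sums[OF A])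
    moreover have "(\<Union>x\<in>A. \<Union>y\<in>(\<lambda>t. - (t *\<^sub>R u)) ` T n. {x + y}) = H n"
      by (force simp: H_def)
    ultimately show ?thesis by simp
  qed
  then have I: "I \<in> sets borel"
    using A by (auto simp: I_def)
  have isolated: "y + t *\<^sub>R u \<notin> A" if "y \<in> I" "0 < \<bar>t\<bar>" "\<bar>t\<bar> \<le> r" for y t
  proof -
    obtain n where "1 / real (Suc n) < \<bar>t\<bar>"
      using \<open>0 < \<bar>t\<bar>\<close> by (rule nat_approx_posE)
    then have "t \<in> T n" using that by (simp add: T_def)
    then show ?thesis using that(1) by (auto simp: I_def H_def)
  qed
  have "AE s in lborel. x + s *\<^sub>R u \<notin> I" for x
  proof -
    let ?S = "{s. x + s *\<^sub>R u \<in> I}"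
    \<comment> \<open>Two parameters in the same cell of length \<open>r\<close> would make each
      point a neighbour of the other in \<open>A\<close>.\<close>
    have "inj_on (\<lambda>s. \<lfloor>s / r\<rfloor>) ?S"
    proof (rule inj_onI)
      fix s s' assume s: "s \<in> ?S" "s' \<in> ?S" "\<lfloor>s / r\<rfloor> = \<lfloor>s' / r\<rfloor>"
      have "\<bar>s / r - s' / r\<bar> \<le> 1"
        using s(3) by linarith
      then have "\<bar>s' - s\<bar> \<le> r"
        using r by (simp add: diff_divide_distrib[symmetric] abs_minus_commute abs_divide)
      moreover have "x + s *\<^sub>R u + (s' - s) *\<^sub>R u \<in> A"
        using s(2) by (simp add: algebra_simps I_def)
      ultimately show "s = s'"
        using isolated[of "x + s *\<^sub>R u" "s' - s"] s(1) by force
    qed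
    then have "countable ?S"
      by (rule countable_image_inj_on[rotated]) simp
    then have "?S \<in> null_sets lborel"
      by (rule countable_imp_null_set_lborel)
    from AE_not_in[OF this] show ?thesis by simp
  qed
  then have AE_I: "AE x in lborel. x \<notin> I"
    using AE_lborel_line_commute[OF I] by blast
  have T_bound: "0 < \<bar>t\<bar> \<and> \<bar>t\<bar> \<le> r" if "t \<in> T n" for t n
    using that by (auto simp: T_def intro: order_less_le_trans[of 0 "1 / (1 + real n)"])
  from AE_I show ?thesis
  proof eventually_elim
    fix x assume "x \<notin> I"
    show "x \<in> A \<longrightarrow> (\<exists>t. 0 < \<bar>t\<bar> \<and> \<bar>t\<bar> \<le> r \<and> x + t *\<^sub>R u \<in> A)"
    proof
      assume "x \<in> A"
      with \<open>x \<notin> I\<close> obtain n where "x \<in> H n" by (auto simp: I_def)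
      then obtain t where "t \<in> T n" "x + t *\<^sub>R u \<in> A" by (auto simp: H_def)
      with T_bound show "\<exists>t. 0 < \<bar>t\<bar> \<and> \<bar>t\<bar> \<le> r \<and> x + t *\<^sub>R u \<in> A" by blast
    qed
  qed
qed

definition has_directional_derivative :: "('a::real_normed_vector \<Rightarrow> real) \<Rightarrow> 'a \<Rightarrow> 'a \<Rightarrow> real \<Rightarrow> bool" where
  "has_directional_derivative f x w D \<longleftrightarrow> ((\<lambda>t. f (x + t *\<^sub>R w)) has_real_derivative D) (at 0)"

lemma has_directional_derivative_bound:
  assumes "has_directional_derivative f x w D" and e: "e > 0"
  obtains d where "d > 0" "\<And>t. \<bar>t\<bar> \<le> d \<Longrightarrow> \<bar>f (x + t *\<^sub>R w) - f x - t * D\<bar> \<le> e * \<bar>t\<bar>"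
proof -
  have "((\<lambda>t. f (x + t *\<^sub>R w)) has_derivative (\<lambda>h. h * D)) (at 0)"
    using assms(1) by (simp add: has_directional_derivative_def has_field_derivative_def mult_commute_abs)
  with e obtain d where "d > 0" and d: "\<And>t. \<bar>t\<bar> < d \<Longrightarrow> \<bar>f (x + t *\<^sub>R w) - f x - t * D\<bar> \<le> e * \<bar>t\<bar>"
    unfolding has_derivative_at_alt by force
  show thesis
    by (rule that[of "d/2"]) (use \<open>d > 0\<close> in \<open>auto intro!: d\<close>)
qed

lemma has_directional_derivative_scaleR:
  assumes "has_directional_derivative f x w D"
  shows "has_directional_derivative f x (k *\<^sub>R w) (k * D)"
proof -
  have 1: "((\<lambda>t. f (x + t *\<^sub>R w)) has_real_derivative D) (at (k * 0))"
    using assms by (simp add: has_directional_derivative_def)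
  have 2: "((\<lambda>t. k * t) has_real_derivative k) (at 0)"
    by (auto intro!: derivative_eq_intros)
  show ?thesis
    using DERIV_chain2[OF 1 2] by (simp add: has_directional_derivative_def mult.commute)
qed

text \<open>
  Split the points by rational approximations \<open>p\<close>, \<open>q\<close> of the derivatives along \<open>u\<close> and \<open>v\<close> and by
  the scale \<open>d\<close> at which they hold. Almost every point \<open>x\<close> of such a closed piece \<open>A\<close> has points
  \<open>x + t u\<close> of \<open>A\<close> arbitrarily close to it, and there the increment along \<open>v\<close> is again about \<open>t q\<close>.
\<close>

lemma AE_directional_derivative_add:
  fixes f :: "'a::euclidean_space \<Rightarrow> real"
  assumes f: "continuous_on UNIV f"
  shows "AE x in lborel. \<forall>a b c. has_directional_derivative f x u a \<longrightarrow> has_directional_derivative f x v b \<longrightarrow>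
           has_directional_derivative f x (u + v) c \<longrightarrow> c = a + b"
proof -
  define A where "A p q e d = {x. \<forall>t\<in>{-d..d}. \<bar>f (x + t *\<^sub>R u) - f x - t * p\<bar> \<le> e * \<bar>t\<bar> \<and>
      \<bar>f (x + t *\<^sub>R v) - f x - t * q\<bar> \<le> e * \<bar>t\<bar>}" for p q e d
  have cont: "continuous_on UNIV (\<lambda>x. f (x + a))" for a
    by (intro continuous_on_compose2[OF f] continuous_intros) auto
  have "A p q e d = (\<Inter>t\<in>{-d..d}. {x. \<bar>f (x + t *\<^sub>R u) - f x - t * p\<bar> \<le> e * \<bar>t\<bar>} \<inter>
      {x. \<bar>f (x + t *\<^sub>R v) - f x - t * q\<bar> \<le> e * \<bar>t\<bar>})" for p q e d
    by (auto simp: A_def)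
  then have "closed (A p q e d)" for p q e d
    by (auto intro!: closed_INT closed_Int closed_Collect_le continuous_intros cont f)
  then have "AE x in lborel. x \<in> A p q e d \<longrightarrow> (\<exists>t. 0 < \<bar>t\<bar> \<and> \<bar>t\<bar> \<le> r \<and> x + t *\<^sub>R u \<in> A p q e d)"
    if "r > 0" for p q e d r
    using that by (rule AE_not_isolated_on_line)
  then have "AE x in lborel. \<forall>p\<in>\<rat>. \<forall>q\<in>\<rat>. \<forall>e\<in>\<rat>. \<forall>d\<in>\<rat>. \<forall>r\<in>\<rat>. r > 0 \<longrightarrow> x \<in> A p q e d \<longrightarrow>
      (\<exists>t. 0 < \<bar>t\<bar> \<and> \<bar>t\<bar> \<le> r \<and> x + t *\<^sub>R u \<in> A p q e d)"
    by (simp add: AE_ball_countable countable_rat)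
  then show ?thesis
  proof (eventually_elim, intro allI impI)
    fix x a b c
    assume x: "\<forall>p\<in>\<rat>. \<forall>q\<in>\<rat>. \<forall>e\<in>\<rat>. \<forall>d\<in>\<rat>. \<forall>r\<in>\<rat>. r > 0 \<longrightarrow> x \<in> A p q e d \<longrightarrow>
      (\<exists>t. 0 < \<bar>t\<bar> \<and> \<bar>t\<bar> \<le> r \<and> x + t *\<^sub>R u \<in> A p q e d)"
      and a: "has_directional_derivative f x u a" and b: "has_directional_derivative f x v b"
      and c: "has_directional_derivative f x (u + v) c"
    have "\<bar>c - (a + b)\<bar> \<le> 0 + e" if "e > 0" for e
    proof -
      \<comment> \<open>The total error is at most \<open>4 * e'\<close>: each of the three
        increments costs \<open>e'\<close>, and replacing \<open>a\<close> and \<open>b\<close> by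
        \<open>p\<close> and \<open>q\<close> costs \<open>e' / 2\<close> each.\<close>
      obtain e' where e': "e' \<in> \<rat>" "0 < e'" "e' < e / 4"
        using Rats_dense_in_real[of 0 "e / 4"] \<open>e > 0\<close> by auto
      obtain p where p: "p \<in> \<rat>" "a < p" "p < a + e' / 2"
        using Rats_dense_in_real[of a "a + e' / 2"] e' by auto
      obtain q where q: "q \<in> \<rat>" "b < q" "q < b + e' / 2"
        using Rats_dense_in_real[of b "b + e' / 2"] e' by auto
      obtain d1 where d1: "d1 > 0" "\<And>t. \<bar>t\<bar> \<le> d1 \<Longrightarrow> \<bar>f (x + t *\<^sub>R u) - f x - t * a\<bar> \<le> e' / 2 * \<bar>t\<bar>"
        using has_directional_derivative_bound[OF a, of "e' / 2"] e' by auto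
      obtain d2 where d2: "d2 > 0" "\<And>t. \<bar>t\<bar> \<le> d2 \<Longrightarrow> \<bar>f (x + t *\<^sub>R v) - f x - t * b\<bar> \<le> e' / 2 * \<bar>t\<bar>"
        using has_directional_derivative_bound[OF b, of "e' / 2"] e' by auto
      obtain d3 where d3: "d3 > 0" "\<And>t. \<bar>t\<bar> \<le> d3 \<Longrightarrow> \<bar>f (x + t *\<^sub>R (u + v)) - f x - t * c\<bar> \<le> e' * \<bar>t\<bar>"
        using has_directional_derivative_bound[OF c, of "e'"] e' by auto
      obtain d where d: "d \<in> \<rat>" "0 < d" "d < min d1 (min d2 d3)"
        using Rats_dense_in_real[of 0 "min d1 (min d2 d3)"] d1 d2 d3 by auto
      \<comment> \<open>Half of the tolerance \<open>e'\<close> goes to the derivative and half to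
        its rational approximation.\<close>
      have shift: "\<bar>y - t * q'\<bar> \<le> e' * \<bar>t\<bar>" if "\<bar>y - t * b'\<bar> \<le> e' / 2 * \<bar>t\<bar>" "b' < q'" "q' < b' + e' / 2" for y t b' q' :: real
      proof -
        have "\<bar>t * b' - t * q'\<bar> = \<bar>t\<bar> * \<bar>b' - q'\<bar>"
          by (simp add: abs_mult[symmetric] algebra_simps)
        also have "\<dots> \<le> \<bar>t\<bar> * (e' / 2)"
          using that by (intro mult_left_mono) auto
        finally have "\<bar>t * b' - t * q'\<bar> \<le> \<bar>t\<bar> * (e' / 2)" .
        moreover have "\<bar>y - t * q'\<bar> \<le> \<bar>y - t * b'\<bar> + \<bar>t * b' - t * q'\<bar>"
          by linarith
        moreover have "e' * \<bar>t\<bar> = e' / 2 * \<bar>t\<bar> + \<bar>t\<bar> * (e' / 2)"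
          by simp
        ultimately show ?thesis using that(1) by linarith
      qed
      have "x \<in> A p q e' d"
        unfolding A_def using d by (auto intro!: shift[OF d1(2) p(2,3)] shift[OF d2(2) q(2,3)])
      then obtain t where t: "0 < \<bar>t\<bar>" "\<bar>t\<bar> \<le> d" "x + t *\<^sub>R u \<in> A p q e' d"
        using x p(1) q(1) e'(1) d(1,2) by blast
      have td: "t \<in> {- d..d}"
        using t(2) by (simp add: abs_le_iff)
      have "\<bar>f (x + t *\<^sub>R u) - f x - t * p\<bar> \<le> e' * \<bar>t\<bar>"
        using \<open>x \<in> A p q e' d\<close> td unfolding A_def by blast
      \<comment> \<open>This increment starts at \<open>x + t u\<close> instead of \<open>x\<close>;
        membership of that point in the same piece \<open>A\<close> controls it with the same
        \<open>q\<close>.\<close>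
      moreover have "\<bar>f (x + t *\<^sub>R u + t *\<^sub>R v) - f (x + t *\<^sub>R u) - t * q\<bar> \<le> e' * \<bar>t\<bar>"
        using t(3) td unfolding A_def by blast
      moreover have "\<bar>f (x + t *\<^sub>R u + t *\<^sub>R v) - f x - t * c\<bar> \<le> e' * \<bar>t\<bar>"
        using d3(2)[of t] t(2) d by (simp add: algebra_simps)
      ultimately have "\<bar>t * c - t * p - t * q\<bar> \<le> 3 * (e' * \<bar>t\<bar>)"
        by linarith
      also have "t * c - t * p - t * q = t * (c - p - q)"
        by (simp add: algebra_simps)
      finally have "\<bar>t\<bar> * \<bar>c - p - q\<bar> \<le> \<bar>t\<bar> * (3 * e')"
        unfolding abs_mult by (simp only: mult_ac)
      then have "\<bar>c - p - q\<bar> \<le> 3 * e'"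
        using t(1) by (simp only: mult_le_cancel_left_pos)
      then show ?thesis using p q e' by linarith
    qed
    then have "\<bar>c - (a + b)\<bar> \<le> 0" by (rule field_le_epsilon)
    then show "c = a + b" by simp
  qed
qed

text \<open>Additivity is applied once for each basis vector to the partial sums of the expansion of
  \<open>u\<close>. The candidate gradient \<open>g\<close> is quantified inside, so the null set
  depends on \<open>u\<close> only.\<close>

lemma AE_directional_derivative_linear:
  fixes f :: "'a::euclidean_space \<Rightarrow> real"
  assumes f: "L-lipschitz_on UNIV f"
  shows "AE x in lborel. \<forall>g. (\<forall>b\<in>Basis. has_directional_derivative f x b (g \<bullet> b)) \<longrightarrow>
           has_directional_derivative f x u (g \<bullet> u)"
proof -
  have cont: "continuous_on UNIV f"
    using f by (rule lipschitz_on_continuous_on)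
  \<comment> \<open>Partial sums over all subsets of the basis: the induction adds basis vectors in
    no fixed order, and there are only finitely many subsets.\<close>
  define U where "U S = (\<Sum>b\<in>S. (u \<bullet> b) *\<^sub>R b)" for S
  have fin: "countable (Pow (Basis :: 'a set))" "countable (Basis :: 'a set)"
    by (auto intro: countable_finite)
  have "AE x in lborel. \<forall>S\<in>Pow Basis. \<exists>c. has_directional_derivative f x (U S) c"
    using AE_directional_derivative[OF f] fin
    by (auto simp: AE_ball_countable has_directional_derivative_def)
  moreover have "AE x in lborel. \<forall>S\<in>Pow Basis. \<forall>b'\<in>Basis. \<forall>a b c. has_directional_derivative f x (U S) a \<longrightarrow>
      has_directional_derivative f x ((u \<bullet> b') *\<^sub>R b') b \<longrightarrow> has_directional_derivative f x (U S + (u \<bullet> b') *\<^sub>R b') c \<longrightarrow> c = a + b"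
    using AE_directional_derivative_add[OF cont] fin by (simp only: AE_ball_countable) blast
  ultimately show ?thesis
  proof (eventually_elim, intro allI impI)
    fix x g
    assume ex: "\<forall>S\<in>Pow Basis. \<exists>c. has_directional_derivative f x (U S) c"
      and add: "\<forall>S\<in>Pow Basis. \<forall>b'\<in>Basis. \<forall>a b c. has_directional_derivative f x (U S) a \<longrightarrow>
      has_directional_derivative f x ((u \<bullet> b') *\<^sub>R b') b \<longrightarrow> has_directional_derivative f x (U S + (u \<bullet> b') *\<^sub>R b') c \<longrightarrow> c = a + b"
      and g: "\<forall>b\<in>Basis. has_directional_derivative f x b (g \<bullet> b)"
    have "has_directional_derivative f x (U S) (\<Sum>b\<in>S. (u \<bullet> b) * (g \<bullet> b))" if "finite S" "S \<subseteq> Basis" for S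
      using that
    proof (induction S)
      case empty
      show ?case by (simp add: U_def has_directional_derivative_def)
    next
      case (insert b S)
      have eq: "U (insert b S) = U S + (u \<bullet> b) *\<^sub>R b"
        using insert by (simp add: U_def add.commute)
      obtain c where c: "has_directional_derivative f x (U (insert b S)) c"
        using ex insert.prems by blast
      have "has_directional_derivative f x ((u \<bullet> b) *\<^sub>R b) ((u \<bullet> b) * (g \<bullet> b))"
        using g insert.prems by (auto intro: has_directional_derivative_scaleR)
      then have "c = (\<Sum>b\<in>S. (u \<bullet> b) * (g \<bullet> b)) + (u \<bullet> b) * (g \<bullet> b)"
        using add insert c unfolding eq by blast
      with c insert show ?case by (simp add: add.commute)
    qed
    from this[OF finite_Basis order_refl] show "has_directional_derivative f x u (g \<bullet> u)"
      by (simp add: U_def euclidean_representation euclidean_inner[of g u] mult.commute)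
  qed
qed

text \<open>Compactness of the unit sphere leaves finitely many directions from \<open>U\<close>
  that approximate all others, so one scale serves them all; the Lipschitz bound absorbs the change
  of direction.\<close>

lemma has_derivative_if_dense_directional:
  fixes f :: "'a::euclidean_space \<Rightarrow> real"
  assumes f: "L-lipschitz_on UNIV f"
    and dense: "\<And>X. open X \<Longrightarrow> X \<noteq> {} \<Longrightarrow> \<exists>u\<in>U. u \<in> X"
    and dir: "\<And>u. u \<in> U \<Longrightarrow> has_directional_derivative f x u (g \<bullet> u)"
  shows "(f has_derivative (\<lambda>h. g \<bullet> h)) (at x)"
  unfolding has_derivative_at_alt
proof (intro conjI allI impI)
  show "bounded_linear (\<lambda>h. g \<bullet> h)" by (rule bounded_linear_inner_right)
  have L: "L \<ge> 0" using f by (rule lipschitz_on_nonneg)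
  fix e :: real assume e: "e > 0"
  \<comment> \<open>Changing the direction by \<open>r\<close> costs at most
    \<open>r * (L + norm g)\<close> per unit length, which is to stay below \<open>e / 2\<close>;
    the summand 1 keeps the denominator positive.\<close>
  define r where "r = e / (2 * (L + norm g + 1))"
  have r: "r > 0" "r * (L + norm g) \<le> e / 2"
    using e L by (auto simp: r_def field_simps add_pos_nonneg add_nonneg_pos)
  have "sphere 0 1 \<subseteq> (\<Union>u\<in>U. ball u r)"
  proof
    fix y :: 'a
    obtain u where "u \<in> U" "u \<in> ball y r"
      using dense[of "ball y r"] r by auto
    then show "y \<in> (\<Union>u\<in>U. ball u r)" by (auto simp: dist_commute)
  qed
  then obtain C where C: "C \<subseteq> U" "finite C" "sphere 0 1 \<subseteq> (\<Union>u\<in>C. ball u r)"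
    by (rule compactE_image[OF compact_sphere open_ball])
  have "\<exists>d>0. \<forall>t. \<bar>t\<bar> \<le> d \<longrightarrow> \<bar>f (x + t *\<^sub>R u) - f x - t * (g \<bullet> u)\<bar> \<le> e / 2 * \<bar>t\<bar>" if "u \<in> U" for u
    using has_directional_derivative_bound[OF dir[OF that], of "e / 2"] e by auto
  then obtain D where D: "\<And>u. u \<in> U \<Longrightarrow> D u > 0"
    "\<And>u t. u \<in> U \<Longrightarrow> \<bar>t\<bar> \<le> D u \<Longrightarrow> \<bar>f (x + t *\<^sub>R u) - f x - t * (g \<bullet> u)\<bar> \<le> e / 2 * \<bar>t\<bar>"
    by metis
  define d where "d = Min (insert 1 (D ` C))"
  have d: "d > 0" "\<And>u. u \<in> C \<Longrightarrow> d \<le> D u"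
    using C D(1) by (auto simp: d_def)
  show "\<exists>d>0. \<forall>y. norm (y - x) < d \<longrightarrow> norm (f y - f x - g \<bullet> (y - x)) \<le> e * norm (y - x)"
  proof (intro exI[of _ d] conjI allI impI d(1))
    fix y assume y: "norm (y - x) < d"
    show "norm (f y - f x - g \<bullet> (y - x)) \<le> e * norm (y - x)"
    proof (cases "y = x")
      case False
      define t where "t = norm (y - x)"
      have t: "t > 0" using False by (simp add: t_def)
      have "(1 / t) *\<^sub>R (y - x) \<in> sphere 0 1"
        using t by (simp add: t_def)
      then have "(1 / t) *\<^sub>R (y - x) \<in> (\<Union>u\<in>C. ball u r)"
        using C(3) by blast
      then obtain u where u: "u \<in> C" "dist u ((1 / t) *\<^sub>R (y - x)) < r"
        by (auto simp del: scaleR_diff_right)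
      \<comment> \<open>The point \<open>y\<close> is compared with the point at the same distance
        from \<open>x\<close> in the nearby direction \<open>u\<close>.\<close>
      have "y - (x + t *\<^sub>R u) = t *\<^sub>R ((1 / t) *\<^sub>R (y - x) - u)"
        using t by (simp add: algebra_simps)
      then have dy: "norm (y - (x + t *\<^sub>R u)) \<le> t * r"
        using u(2) t by (simp add: dist_norm norm_minus_commute)
      have 1: "\<bar>f y - f (x + t *\<^sub>R u)\<bar> \<le> L * (t * r)"
        using lipschitz_onD[OF f, of y "x + t *\<^sub>R u"] mult_left_mono[OF dy L] by (simp add: dist_norm)
      have "\<bar>g \<bullet> (y - (x + t *\<^sub>R u))\<bar> \<le> norm g * (t * r)"
        using order_trans[OF Cauchy_Schwarz_ineq2 mult_left_mono[OF dy norm_ge_zero]] .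
      then have 2: "\<bar>g \<bullet> (y - x) - t * (g \<bullet> u)\<bar> \<le> norm g * (t * r)"
        by (simp add: inner_diff_right inner_add_right algebra_simps)
      have 3: "\<bar>f (x + t *\<^sub>R u) - f x - t * (g \<bullet> u)\<bar> \<le> e / 2 * t"
        using D(2)[of u t] C(1) u(1) d(2)[of u] y t by (auto simp: t_def)
      have "\<bar>f y - f x - g \<bullet> (y - x)\<bar> \<le> L * (t * r) + norm g * (t * r) + e / 2 * t"
        using 1 2 3 by linarith
      also have "\<dots> = t * (r * (L + norm g)) + e / 2 * t"
        by (simp add: algebra_simps)
      also have "\<dots> \<le> t * (e / 2) + e / 2 * t"
        using r(2) t by (intro add_right_mono mult_left_mono) auto
      finally show ?thesis by (simp add: t_def)
    qed simp
  qed
qed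

text \<open>A countable dense set of directions needs only one null set: off it the partial
  derivatives exist and determine all directional derivatives along \<open>U\<close>
  linearly.\<close>

theorem rademacher:
  fixes f :: "'a::euclidean_space \<Rightarrow> real"
  assumes f: "L-lipschitz_on UNIV f"
  shows "AE x in lborel. f differentiable (at x)"
proof -
  obtain U :: "'a set" where U: "countable U" "\<And>X. open X \<Longrightarrow> X \<noteq> {} \<Longrightarrow> \<exists>u\<in>U. u \<in> X"
    using countable_dense_exists by blast
  have "AE x in lborel. \<forall>u\<in>U. \<forall>g. (\<forall>b\<in>Basis. has_directional_derivative f x b (g \<bullet> b)) \<longrightarrow>
           has_directional_derivative f x u (g \<bullet> u)"
    using AE_directional_derivative_linear[OF f] U(1) by (simp add: AE_ball_countable)
  moreover have "AE x in lborel. \<forall>b\<in>Basis. \<exists>c. has_directional_derivative f x b c"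
    using AE_directional_derivative[OF f]
    by (simp add: AE_ball_countable countable_finite has_directional_derivative_def)
  ultimately show ?thesis
  proof eventually_elim
    fix x
    assume lin: "\<forall>u\<in>U. \<forall>g. (\<forall>b\<in>Basis. has_directional_derivative f x b (g \<bullet> b)) \<longrightarrow>
           has_directional_derivative f x u (g \<bullet> u)"
      and "\<forall>b\<in>Basis. \<exists>c. has_directional_derivative f x b c"
    then obtain c where c: "\<And>b. b \<in> Basis \<Longrightarrow> has_directional_derivative f x b (c b)"
      by metis
    define g where "g = (\<Sum>b\<in>Basis. c b *\<^sub>R b)"
    have "g \<bullet> b = c b" if "b \<in> Basis" for b
      using that by (simp add: g_def)
    then have "has_directional_derivative f x u (g \<bullet> u)" if "u \<in> U" for u
      using lin c that by simp
    from has_derivative_if_dense_directional[OF f U(2) this]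
    show "f differentiable (at x)"
      by (auto simp: differentiable_def)
  qed
qed

subsection \<open>Monotonicity of absolutely continuous functions\<close>

lemma absolutely_continuous_on_interval_subset:
  assumes "absolutely_continuous_on_interval a b \<phi>" "a \<le> c" "d \<le> b"
  shows "absolutely_continuous_on_interval c d \<phi>"
  using assms unfolding absolutely_continuous_on_interval_def
  by (meson order_trans)

lemma absolutely_continuous_imp_continuous_on:
  assumes "absolutely_continuous_on_interval a b \<phi>"
  shows "continuous_on {a..b} \<phi>"
  unfolding continuous_on_iff
proof (intro ballI allI impI)
  fix x e :: real assume x: "x \<in> {a..b}" and e: "e > 0"
  obtain d where d: "d > 0" "\<And>(m::nat) u v. (\<forall>i<m. a \<le> u i \<and> u i \<le> v i \<and> v i \<le> b) \<Longrightarrow>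
      disjoint_family_on (\<lambda>i. {u i<..<v i}) {..<m} \<Longrightarrow> (\<Sum>i<m. v i - u i) < d \<Longrightarrow>
      (\<Sum>i<m. norm (\<phi> (v i) - \<phi> (u i))) < e"
    using assms e unfolding absolutely_continuous_on_interval_def by meson
  have *: "norm (\<phi> t - \<phi> s) < e" if "a \<le> s" "s \<le> t" "t \<le> b" "t - s < d" for s t
    using d(2)[of 1 "\<lambda>_. s" "\<lambda>_. t"] that by (simp add: disjoint_family_on_def)
  show "\<exists>d>0. \<forall>x'\<in>{a..b}. dist x' x < d \<longrightarrow> dist (\<phi> x') (\<phi> x) < e"
  proof (intro exI[of _ d] conjI ballI impI d(1))
    fix x' assume "x' \<in> {a..b}" "dist x' x < d"
    then show "dist (\<phi> x') (\<phi> x) < e"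
      using *[of x x'] *[of x' x] x
      by (cases "x \<le> x'") (auto simp: dist_norm dist_real_def norm_minus_commute)
  qed
qed

lemma absolutely_continuous_compose_lipschitz:
  assumes \<phi>: "absolutely_continuous_on_interval a b \<phi>"
    and f: "L-lipschitz_on S f" and S: "\<phi> ` {a..b} \<subseteq> S"
  shows "absolutely_continuous_on_interval a b (\<lambda>t. f (\<phi> t))"
  unfolding absolutely_continuous_on_interval_def
proof (intro allI impI)
  fix e :: real assume e: "e > 0"
  have L: "L \<ge> 0" using f by (rule lipschitz_on_nonneg)
  have "e / (L + 1) > 0" using e L by simp
  then obtain d where d: "d > 0" "\<And>(m::nat) u v. (\<forall>i<m. a \<le> u i \<and> u i \<le> v i \<and> v i \<le> b) \<and>
      disjoint_family_on (\<lambda>i. {u i<..<v i}) {..<m} \<and> (\<Sum>i<m. v i - u i) < d \<Longrightarrow>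
      (\<Sum>i<m. norm (\<phi> (v i) - \<phi> (u i))) < e / (L + 1)"
    using \<phi> unfolding absolutely_continuous_on_interval_def by meson
  show "\<exists>d>0. \<forall>(m::nat) u v. (\<forall>i<m. a \<le> u i \<and> u i \<le> v i \<and> v i \<le> b) \<and>
      disjoint_family_on (\<lambda>i. {u i<..<v i}) {..<m} \<and> (\<Sum>i<m. v i - u i) < d \<longrightarrow>
      (\<Sum>i<m. norm (f (\<phi> (v i)) - f (\<phi> (u i)))) < e"
  proof (intro exI[of _ d] conjI allI impI d(1))
    fix m :: nat and u v
    assume uv: "(\<forall>i<m. a \<le> u i \<and> u i \<le> v i \<and> v i \<le> b) \<and>
      disjoint_family_on (\<lambda>i. {u i<..<v i}) {..<m} \<and> (\<Sum>i<m. v i - u i) < d"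
    have "norm (f (\<phi> (v i)) - f (\<phi> (u i))) \<le> L * norm (\<phi> (v i) - \<phi> (u i))" if "i < m" for i
    proof -
      have "u i \<in> {a..b}" "v i \<in> {a..b}" using uv that by force+
      then have "\<phi> (u i) \<in> S" "\<phi> (v i) \<in> S" using S by blast+
      then show ?thesis
        using lipschitz_onD[OF f, of "\<phi> (v i)" "\<phi> (u i)"] by (simp add: dist_norm)
    qed
    then have "(\<Sum>i<m. norm (f (\<phi> (v i)) - f (\<phi> (u i)))) \<le> L * (\<Sum>i<m. norm (\<phi> (v i) - \<phi> (u i)))"
      unfolding sum_distrib_left by (intro sum_mono) auto
    also have "\<dots> \<le> L * (e / (L + 1))"
      using d(2)[OF uv] L by (intro mult_left_mono) auto
    also have "\<dots> < e" using e L by (simp add: field_simps)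
    finally show "(\<Sum>i<m. norm (f (\<phi> (v i)) - f (\<phi> (u i)))) < e" .
  qed
qed

lemma absolutely_continuous_on_interval_id: "absolutely_continuous_on_interval a b (\<lambda>t::real. t)"
  unfolding absolutely_continuous_on_interval_def
proof (intro allI impI)
  fix e :: real assume e: "e > 0"
  show "\<exists>d>0. \<forall>(m::nat) u v. (\<forall>i<m. a \<le> u i \<and> u i \<le> v i \<and> v i \<le> b) \<and>
      disjoint_family_on (\<lambda>i. {u i<..<v i}) {..<m} \<and> (\<Sum>i<m. v i - u i) < d \<longrightarrow>
      (\<Sum>i<m. norm (v i - u i)) < e"
  proof (intro exI[of _ e] conjI allI impI e)
    fix m :: nat and u v
    assume uv: "(\<forall>i<m. a \<le> u i \<and> u i \<le> v i \<and> v i \<le> b) \<and>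
      disjoint_family_on (\<lambda>i. {u i<..<v i}) {..<m} \<and> (\<Sum>i<m. v i - u i) < e"
    then have "(\<Sum>i<m. norm (v i - u i)) = (\<Sum>i<m. v i - u i)"
      by (intro sum.cong) auto
    with uv show "(\<Sum>i<m. norm (v i - u i)) < e" by simp
  qed
qed

text \<open>Arbitrary finite index sets replace initial segments of the naturals, so that the pieces
  of a tagged division can serve as indices.\<close>

lemma absolutely_continuous_finite_family:
  assumes g: "absolutely_continuous_on_interval a b g" and e: "e > 0"
  obtains d where "d > 0" "\<And>p l r. finite p \<Longrightarrow> (\<And>i. i \<in> p \<Longrightarrow> a \<le> l i \<and> l i \<le> r i \<and> r i \<le> b) \<Longrightarrow>
     disjoint_family_on (\<lambda>i. {l i<..<r i}) p \<Longrightarrow> (\<Sum>i\<in>p. r i - l i) < d \<Longrightarrow>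
     (\<Sum>i\<in>p. norm (g (r i) - g (l i))) < e"
proof -
  obtain d where d: "d > 0" "\<And>(m::nat) u v. (\<forall>i<m. a \<le> u i \<and> u i \<le> v i \<and> v i \<le> b) \<and>
      disjoint_family_on (\<lambda>i. {u i<..<v i}) {..<m} \<and> (\<Sum>i<m. v i - u i) < d \<Longrightarrow>
      (\<Sum>i<m. norm (g (v i) - g (u i))) < e"
    using g e unfolding absolutely_continuous_on_interval_def by meson
  show thesis
  proof (rule that[OF d(1)])
    fix p :: "'b set" and l r
    assume p: "finite p" and lr: "\<And>i. i \<in> p \<Longrightarrow> a \<le> l i \<and> l i \<le> r i \<and> r i \<le> b"
      and disj: "disjoint_family_on (\<lambda>i. {l i<..<r i}) p" and sum: "(\<Sum>i\<in>p. r i - l i) < d"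
    obtain h where h: "bij_betw h {..<card p} p"
      using ex_bij_betw_nat_finite[OF p] by (auto simp: atLeast0LessThan)
    have reindex: "(\<Sum>i<card p. F (h i)) = (\<Sum>i\<in>p. F i)" for F :: "'b \<Rightarrow> real"
      using sum.reindex_bij_betw[OF h] .
    have "disjoint_family_on (\<lambda>i. {l (h i)<..<r (h i)}) {..<card p}"
      unfolding disjoint_family_on_def
    proof (intro ballI impI)
      fix i j assume ij: "i \<in> {..<card p}" "j \<in> {..<card p}" "i \<noteq> j"
      then have "h i \<in> p" "h j \<in> p" "h i \<noteq> h j"
        using h by (auto simp: bij_betw_def inj_on_def)
      with disj show "{l (h i)<..<r (h i)} \<inter> {l (h j)<..<r (h j)} = {}"
        unfolding disjoint_family_on_def by blast
    qed
    moreover have "\<forall>i<card p. a \<le> l (h i) \<and> l (h i) \<le> r (h i) \<and> r (h i) \<le> b"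
      using lr bij_betw_apply[OF h] by auto
    ultimately have "(\<Sum>i<card p. norm (g (r (h i)) - g (l (h i)))) < e"
      using sum reindex[of "\<lambda>i. r i - l i"] by (intro d(2)) auto
    then show "(\<Sum>i\<in>p. norm (g (r i) - g (l i))) < e"
      by (simp add: reindex[of "\<lambda>i. norm (g (r i) - g (l i))"])
  qed
qed

lemma sum_lengths_le_emeasure:
  fixes l r :: "'i \<Rightarrow> real"
  assumes "finite p" "\<And>i. i \<in> p \<Longrightarrow> l i \<le> r i" "disjoint_family_on (\<lambda>i. {l i<..<r i}) p"
    and T: "open T" "\<And>i. i \<in> p \<Longrightarrow> {l i<..<r i} \<subseteq> T"
  shows "ennreal (\<Sum>i\<in>p. r i - l i) \<le> emeasure lborel T"
proof -
  have "ennreal (\<Sum>i\<in>p. r i - l i) = (\<Sum>i\<in>p. emeasure lborel {l i<..<r i})"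
    using assms(2) by (subst sum_ennreal[symmetric]) (auto intro!: sum.cong)
  also have "\<dots> = emeasure lborel (\<Union>i\<in>p. {l i<..<r i})"
    using assms by (intro sum_emeasure) auto
  also have "\<dots> \<le> emeasure lborel T"
    using T by (intro emeasure_mono) auto
  finally show ?thesis .
qed

text \<open>A fine tagged division is split by its tags: outside \<open>N\<close> the slope bound
  controls the increments, and over \<open>N\<close> the pieces have small total length, so absolute
  continuity does. The increments telescope to \<open>g b - g a\<close>.\<close>

lemma absolutely_continuous_nonincreasing:
  fixes g :: "real \<Rightarrow> real"
  assumes ab: "a \<le> b" and ac: "absolutely_continuous_on_interval a b g"
    and N: "N \<in> null_sets lebesgue"
    and slope: "\<And>t e. t \<in> {a..b} \<Longrightarrow> t \<notin> N \<Longrightarrow> e > 0 \<Longrightarrow>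
      \<exists>d>0. \<forall>u v. a \<le> u \<and> u \<le> t \<and> t \<le> v \<and> v \<le> b \<and> v - u < d \<longrightarrow> g v - g u \<le> e * (v - u)"
  shows "g b \<le> g a"
proof (rule field_le_epsilon)
  fix e :: real assume e: "e > 0"
  \<comment> \<open>Over the whole interval this slope contributes at most \<open>e / 2\<close>; the
    summand 1 covers \<open>a = b\<close>.\<close>
  define e1 where "e1 = e / (2 * (b - a + 1))"
  have e1: "e1 > 0" "e1 * (b - a) \<le> e / 2"
    using e ab by (auto simp: e1_def field_simps)
  have "e / 2 > 0" using e by simp
  from ac this obtain d where d: "d > 0"
    "\<And>(p :: (real \<times> real set) set) l r. finite p \<Longrightarrow> (\<And>i. i \<in> p \<Longrightarrow> a \<le> l i \<and> l i \<le> r i \<and> r i \<le> b) \<Longrightarrow>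
     disjoint_family_on (\<lambda>i. {l i<..<r i}) p \<Longrightarrow> (\<Sum>i\<in>p. r i - l i) < d \<Longrightarrow>
     (\<Sum>i\<in>p. norm (g (r i) - g (l i))) < e / 2"
    by (rule absolutely_continuous_finite_family) blast
  \<comment> \<open>The threshold \<open>d\<close> of absolute continuity bounds the measure of an
    open neighbourhood of \<open>N\<close>.\<close>
  obtain T where T: "open T" "N \<subseteq> T" "emeasure lebesgue (T - N) < ennreal d"
    by (rule sets_lebesgue_outer_open[OF null_setsD2[OF N] d(1)])
  have "emeasure lebesgue (T - N) = emeasure lebesgue T"
    using N T(1) by (intro emeasure_Diff_null_set) auto
  then have Td: "emeasure lborel T < ennreal d"
    using T by simp
  obtain D where D: "\<And>t. t \<in> {a..b} \<Longrightarrow> t \<notin> N \<Longrightarrow> D t > 0"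
    "\<And>t u v. t \<in> {a..b} \<Longrightarrow> t \<notin> N \<Longrightarrow> a \<le> u \<Longrightarrow> u \<le> t \<Longrightarrow> t \<le> v \<Longrightarrow> v \<le> b \<Longrightarrow> v - u < D t \<Longrightarrow>
       g v - g u \<le> e1 * (v - u)"
    using slope[OF _ _ e1(1)] by metis
  \<comment> \<open>Intervals tagged in \<open>N\<close> lie in \<open>T\<close> and have small total length, the others satisfy the slope bound.\<close>
  define \<gamma> where "\<gamma> t = (if t \<in> N then T else if t \<in> {a..b} then ball t (D t / 2) else UNIV)" for t
  have "gauge \<gamma>"
    using T D(1) by (auto simp: gauge_def \<gamma>_def)
  then obtain p where p: "p tagged_division_of {a..b}" "\<gamma> fine p"
    by (rule fine_division_exists_real)
  \<comment> \<open>Endpoints are recovered as infimum and supremum to match the telescoping sum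
    over tagged divisions.\<close>
  define l r where "l = (\<lambda>i :: real \<times> real set. Inf (snd i))" and "r = (\<lambda>i :: real \<times> real set. Sup (snd i))"
  have fin: "finite p" using p(1) by auto
  have piece: "snd i = {l i..r i} \<and> a \<le> l i \<and> l i \<le> fst i \<and> fst i \<le> r i \<and> r i \<le> b \<and> snd i \<subseteq> \<gamma> (fst i)"
    if i: "i \<in> p" for i
  proof -
    obtain t K where tK: "i = (t, K)" by (cases i)
    have K: "t \<in> K" "K \<subseteq> {a..b}" "\<exists>u v. K = cbox u v"
      using tagged_division_ofD(2-4)[OF p(1)] i tK by auto
    then obtain u v where uv: "K = {u..v}" "u \<le> v" by auto
    moreover have "K \<subseteq> \<gamma> t" using p(2) i tK by (auto simp: fine_def)
    ultimately show ?thesis using K tK by (auto simp: l_def r_def)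
  qed
  have lr: "a \<le> l i \<and> l i \<le> r i \<and> r i \<le> b" if "i \<in> p" for i
    using piece[OF that] by linarith
  have disj: "disjoint_family_on (\<lambda>i. {l i<..<r i}) p"
    unfolding disjoint_family_on_def
  proof (intro ballI impI)
    fix i j assume ij: "i \<in> p" "j \<in> p" "i \<noteq> j"
    then have "interior (snd i) \<inter> interior (snd j) = {}"
      using tagged_division_ofD(5)[OF p(1), of "fst i" "snd i" "fst j" "snd j"] by (simp add: prod_eq_iff)
    then show "{l i<..<r i} \<inter> {l j<..<r j} = {}"
      using piece ij by (metis interior_atLeastAtMost_real)
  qed
  define pN where "pN = {i \<in> p. fst i \<in> N}"
  have pN: "pN \<subseteq> p" "finite pN" using fin by (auto simp: pN_def)
  have disjN: "disjoint_family_on (\<lambda>i. {l i<..<r i}) pN"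
    using disj pN(1) by (rule disjoint_family_on_mono[rotated])
  have "ennreal (\<Sum>i\<in>pN. r i - l i) \<le> emeasure lborel T"
  proof (rule sum_lengths_le_emeasure[OF pN(2) _ disjN T(1)])
    fix i assume i: "i \<in> pN"
    then show "l i \<le> r i" using lr[of i] pN(1) by auto
    have "snd i \<subseteq> T" using piece[of i] i by (auto simp: pN_def \<gamma>_def)
    then show "{l i<..<r i} \<subseteq> T" using piece[of i] i by (auto simp: pN_def)
  qed
  with Td have "ennreal (\<Sum>i\<in>pN. r i - l i) < ennreal d" by (rule le_less_trans[rotated])
  then have "(\<Sum>i\<in>pN. r i - l i) < d"
    by (meson ennreal_leI not_less)
  then have "(\<Sum>i\<in>pN. norm (g (r i) - g (l i))) < e / 2"
    using lr pN(1) by (intro d(2) pN disjN) auto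
  moreover have "(\<Sum>i\<in>pN. g (r i) - g (l i)) \<le> (\<Sum>i\<in>pN. norm (g (r i) - g (l i)))"
    by (intro sum_mono) auto
  ultimately have sN: "(\<Sum>i\<in>pN. g (r i) - g (l i)) \<le> e / 2" by linarith
  have "(\<Sum>i\<in>p - pN. g (r i) - g (l i)) \<le> (\<Sum>i\<in>p - pN. e1 * (r i - l i))"
  proof (intro sum_mono)
    fix i assume "i \<in> p - pN"
    then have i: "i \<in> p" "fst i \<notin> N" by (auto simp: pN_def)
    note pc = piece[OF i(1)]
    have "fst i \<in> {a..b}" using pc by auto
    then have "{l i..r i} \<subseteq> ball (fst i) (D (fst i) / 2)"
      using pc i by (auto simp: \<gamma>_def)
    moreover have "l i \<in> {l i..r i}" "r i \<in> {l i..r i}"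
      using pc by auto
    ultimately have "l i \<in> ball (fst i) (D (fst i) / 2)" "r i \<in> ball (fst i) (D (fst i) / 2)"
      by blast+
    then have "\<bar>fst i - l i\<bar> < D (fst i) / 2" "\<bar>fst i - r i\<bar> < D (fst i) / 2"
      by (simp_all add: dist_real_def)
    then have "r i - l i < D (fst i)" by linarith
    then show "g (r i) - g (l i) \<le> e1 * (r i - l i)"
      using pc i by (intro D(2)[of "fst i"]) auto
  qed
  also have "\<dots> \<le> (\<Sum>i\<in>p. e1 * (r i - l i))"
    using fin e1 lr by (intro sum_mono2) auto
  also have "\<dots> = e1 * (\<Sum>i\<in>p. r i - l i)"
    by (simp add: sum_distrib_left)
  also have "(\<Sum>i\<in>p. r i - l i) = b - a"
    using additive_tagged_division_1[OF ab p(1), of "\<lambda>t. t"] by (simp add: l_def r_def case_prod_beta)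
  finally have "(\<Sum>i\<in>p - pN. g (r i) - g (l i)) \<le> e / 2"
    using e1(2) by linarith
  moreover have "(\<Sum>i\<in>p. g (r i) - g (l i)) = g b - g a"
    using additive_tagged_division_1[OF ab p(1), of g] by (simp add: l_def r_def case_prod_beta)
  moreover have "(\<Sum>i\<in>p. g (r i) - g (l i)) = (\<Sum>i\<in>p - pN. g (r i) - g (l i)) + (\<Sum>i\<in>pN. g (r i) - g (l i))"
    using fin pN(1) by (simp add: sum.subset_diff)
  ultimately show "g b \<le> g a + e" using sN by linarith
qed

lemma lipschitz_on_imp_absolutely_continuous:
  assumes "L-lipschitz_on {a..b} g"
  shows "absolutely_continuous_on_interval a b g"
  using absolutely_continuous_compose_lipschitz[OF absolutely_continuous_on_interval_id assms] by simp

text \<open>The linear parts on both sides of \<open>t\<close> can only lower the increment, so just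
  the two first-order errors remain.\<close>

lemma derivative_straddle_bound:
  fixes g :: "real \<Rightarrow> real"
  assumes g: "(g has_real_derivative D) (at t)" and D: "D \<le> 0" and e: "e > 0"
  shows "\<exists>d>0. \<forall>u v. u \<le> t \<and> t \<le> v \<and> v - u < d \<longrightarrow> g v - g u \<le> e * (v - u)"
proof -
  have "(g has_derivative (\<lambda>h. h * D)) (at t)"
    using g by (simp add: has_field_derivative_def mult_commute_abs)
  with e obtain d where d: "d > 0" "\<And>y. \<bar>y - t\<bar> < d \<Longrightarrow> \<bar>g y - g t - (y - t) * D\<bar> \<le> e * \<bar>y - t\<bar>"
    unfolding has_derivative_at_alt by force
  show ?thesis
  proof (intro exI[of _ d] conjI allI impI d(1))
    fix u v assume uv: "u \<le> t \<and> t \<le> v \<and> v - u < d"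
    have "\<bar>g v - g t - (v - t) * D\<bar> \<le> e * (v - t)" "\<bar>g u - g t - (u - t) * D\<bar> \<le> e * (t - u)"
      using d(2)[of v] d(2)[of u] uv by auto
    moreover have "(v - t) * D \<le> 0" "(u - t) * D \<ge> 0"
      using uv D by (auto simp: mult_nonneg_nonpos mult_nonpos_nonpos)
    ultimately show "g v - g u \<le> e * (v - u)"
      unfolding right_diff_distrib by linarith
  qed
qed

section \<open>Descent along a fixed direction\<close>

text \<open>For almost every starting point the line in direction \<open>w\<close> meets the bad
  points in a null set of parameters, and there monotonicity follows from the sign of the
  derivative. The remaining starting points that violate the claim form an open null set, which is
  empty.\<close>

lemma nonincreasing_along_direction:
  fixes f :: "'a::euclidean_space \<Rightarrow> real"
  assumes r: "r > 0" and f: "L-lipschitz_on (cball x0 r) f" and N: "N \<in> null_sets lebesgue"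
    and grad: "\<And>z. z \<in> ball x0 r \<Longrightarrow> z \<notin> N \<Longrightarrow> f differentiable (at z) \<Longrightarrow> gradient f z \<bullet> w \<le> 0"
    and y: "y \<in> ball x0 r" "y + s *\<^sub>R w \<in> ball x0 r" and s: "s \<ge> 0"
  shows "f (y + s *\<^sub>R w) \<le> f y"
proof -
  \<comment> \<open>A globally Lipschitz extension, needed to apply Rademacher's theorem.\<close>
  define g where "g z = f (closest_point (cball x0 r) z)" for z
  have g: "L-lipschitz_on UNIV g"
  proof (rule lipschitz_onI)
    fix x y
    have "cball x0 r \<noteq> {}" using r by simp
    note cp = closest_point_in_set[OF closed_cball this] closest_point_lipschitz[OF convex_cball closed_cball this]
    show "dist (g x) (g y) \<le> L * dist x y"
      unfolding g_def using lipschitz_onD[OF f cp(1) cp(1)] cp(2)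
      by (meson f lipschitz_on_nonneg mult_left_mono order_trans)
  qed (rule lipschitz_on_nonneg[OF f])
  have g_eq: "g z = f z" if "z \<in> ball x0 r" for z
    using that by (simp add: g_def closest_point_self)
  have "AE z in lborel. z \<notin> N"
    using AE_not_in[OF N] by (simp add: AE_completion_iff)
  with rademacher[OF g] have "AE z in lborel. g differentiable (at z) \<and> z \<notin> N"
    by eventually_elim simp
  \<comment> \<open>\<open>M\<close> collects \<open>N\<close> and the points of
    nondifferentiability in one Borel null set, as Fubini's theorem requires.\<close>
  then obtain M where M: "M \<in> null_sets lborel" "\<And>z. z \<notin> M \<Longrightarrow> g differentiable (at z) \<and> z \<notin> N"
    by (elim AE_E3) auto
  then have "AE z in lborel. z \<notin> M" "M \<in> sets borel"
    by (auto dest: AE_not_in)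
  then have AE_line: "AE z in lborel. AE s in (lborel :: real measure). z + s *\<^sub>R w \<notin> M"
    by (simp add: AE_lborel_line_commute)
  have good: "g (z + s *\<^sub>R w) \<le> g z"
    if z: "AE s in (lborel :: real measure). z + s *\<^sub>R w \<notin> M" "z \<in> ball x0 r" "z + s *\<^sub>R w \<in> ball x0 r" for z
  proof -
    obtain N' where N': "N' \<in> null_sets lborel" "\<And>t. t \<notin> N' \<Longrightarrow> z + t *\<^sub>R w \<notin> M"
      using z(1) by (elim AE_E3) auto
    have "g (z + s *\<^sub>R w) \<le> g (z + 0 *\<^sub>R w)"
    proof (rule absolutely_continuous_nonincreasing[OF s])
      show "absolutely_continuous_on_interval 0 s (\<lambda>t. g (z + t *\<^sub>R w))"
        by (rule lipschitz_on_imp_absolutely_continuous[OF lipschitz_on_subset[OF lipschitz_on_line[OF g]]]) simp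
      show "N' \<in> null_sets lebesgue"
        using N'(1) by (rule null_sets_completionI)
      fix t e :: real assume t: "t \<in> {0..s}" "t \<notin> N'" and e: "e > 0"
      have "z + t *\<^sub>R w \<in> ball x0 r"
      proof (cases "s = 0")
        case False
        then have "z + t *\<^sub>R w = (1 - t / s) *\<^sub>R z + (t / s) *\<^sub>R (z + s *\<^sub>R w)"
          by (simp add: algebra_simps)
        also have "\<dots> \<in> ball x0 r"
          using t s False z by (intro convexD[OF convex_ball]) auto
        finally show ?thesis .
      qed (use t z in simp)
      moreover have "z + t *\<^sub>R w \<notin> M" using N' t by simp
      ultimately have zt: "z + t *\<^sub>R w \<in> ball x0 r" "g differentiable (at (z + t *\<^sub>R w))" "z + t *\<^sub>R w \<notin> N"
        using M(2) by auto
      let ?D = "gradient g (z + t *\<^sub>R w)"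
      have Dg: "(g has_derivative (\<lambda>h. h \<bullet> ?D)) (at (z + t *\<^sub>R w))"
        using GDERIV_gradient[OF zt(2)] by (simp add: gderiv_def)
      then have Df: "(f has_derivative (\<lambda>h. h \<bullet> ?D)) (at (z + t *\<^sub>R w))"
        by (rule has_derivative_transform_within_open[OF _ open_ball zt(1)]) (rule g_eq)
      then have "gradient f (z + t *\<^sub>R w) = ?D"
        by (intro gradient_eqI) (simp add: gderiv_def)
      then have "w \<bullet> ?D \<le> 0"
        using grad[OF zt(1,3)] Df by (auto simp: differentiable_def inner_commute)
      moreover have "((\<lambda>t. g (z + t *\<^sub>R w)) has_real_derivative (w \<bullet> ?D)) (at t)"
      proof -
        have "((\<lambda>t. z + t *\<^sub>R w) has_derivative (\<lambda>h. h *\<^sub>R w)) (at t)"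
          by (auto intro!: derivative_eq_intros)
        from has_derivative_compose[OF this Dg]
        show ?thesis by (simp add: has_field_derivative_def mult_commute_abs)
      qed
      ultimately show "\<exists>d>0. \<forall>u v. 0 \<le> u \<and> u \<le> t \<and> t \<le> v \<and> v \<le> s \<and> v - u < d \<longrightarrow>
          g (z + v *\<^sub>R w) - g (z + u *\<^sub>R w) \<le> e * (v - u)"
        using derivative_straddle_bound[OF _ _ e] by blast
    qed
    then show ?thesis by simp
  qed
  \<comment> \<open>The starting points that violate the inequality: open by continuity of
    \<open>g\<close>, null by \<open>good\<close>.\<close>
  define W where "W = ball x0 r \<inter> {z. z + s *\<^sub>R w \<in> ball x0 r} \<inter> {z. g z < g (z + s *\<^sub>R w)}"
  have contg: "continuous_on UNIV g" using g by (rule lipschitz_on_continuous_on)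
  have "open {z. z + s *\<^sub>R w \<in> ball x0 r}"
    unfolding mem_ball by (intro open_Collect_less continuous_intros)
  moreover have "open {z. g z < g (z + s *\<^sub>R w)}"
    by (intro open_Collect_less contg continuous_on_compose2[OF contg] continuous_intros) auto
  ultimately have W: "open W" by (auto simp: W_def)
  have "AE z in lborel. z \<notin> W"
    using AE_line by eventually_elim (use good in \<open>force simp: W_def\<close>)
  then have "emeasure lborel W = 0"
    using W by (subst (asm) AE_iff_null_sets[symmetric]) auto
  then have "negligible W"
    using W by (simp add: negligible_iff_null_sets null_sets_def)
  then have "W = {}" using W open_not_negligible by blast
  then have "g (y + s *\<^sub>R w) \<le> g y"
    using y by (auto simp: W_def)
  then show ?thesis using y by (simp add: g_eq)
qed

subsection \<open>Invariance of the sublevel set\<close>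

text \<open>The supremum of the admissible radii is 1-Lipschitz, because moving the centre by a
  distance costs at most that much radius. A third of it is a suitable
  \<open>\<epsilon>\<close>.\<close>

lemma continuous_radius_function:
  fixes Q :: "'a::metric_space \<Rightarrow> real \<Rightarrow> bool"
  assumes ex: "\<And>x. \<exists>r>0. Q x r"
    and shrink: "\<And>x y r s. Q x r \<Longrightarrow> 0 < s \<Longrightarrow> s + dist x y \<le> r \<Longrightarrow> Q y s"
  shows "\<exists>\<epsilon>. continuous_on UNIV \<epsilon> \<and> (\<forall>x. \<epsilon> x > 0) \<and> (\<forall>x. \<exists>r>0. Q x r \<and> (\<forall>y\<in>ball x r. \<epsilon> y \<le> r))"
proof -
  \<comment> \<open>The cap 1 keeps the supremum finite where all radii are admissible.\<close>
  define S where "S x = {r. 0 < r \<and> r \<le> 1 \<and> Q x r}" for x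
  define R where "R x = Sup (S x)" for x
  have S_ne: "S x \<noteq> {}" for x
  proof -
    obtain r where "r > 0" "Q x r" using ex by blast
    then have "min r 1 \<in> S x" using shrink[of x r "min r 1" x] by (auto simp: S_def)
    then show ?thesis by blast
  qed
  have bdd: "bdd_above (S x)" for x by (auto simp: S_def intro: bdd_aboveI[of _ 1])
  have upper: "r \<le> R x" if "r \<in> S x" for r x
    unfolding R_def using that bdd by (rule cSup_upper)
  have R_pos: "R x > 0" for x
  proof -
    obtain r where "r \<in> S x" using S_ne by blast
    then show ?thesis using upper[of r x] by (auto simp: S_def)
  qed
  have R_le: "R x \<le> R y + dist x y" for x y
    unfolding R_def[of x]
  proof (rule cSup_least[OF S_ne])
    fix r assume r: "r \<in> S x"
    show "r \<le> R y + dist x y"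
    proof (cases "r \<le> dist x y")
      case True
      then show ?thesis using R_pos[of y] by linarith
    next
      case False
      have "Q x r" using r by (simp add: S_def)
      then have "Q y (r - dist x y)"
        by (rule shrink) (use False in simp_all)
      moreover have "r - dist x y \<le> 1"
        using r zero_le_dist[of x y] unfolding S_def mem_Collect_eq by linarith
      ultimately have "r - dist x y \<in> S y"
        using False by (simp add: S_def)
      from upper[OF this] show ?thesis by linarith
    qed
  qed
  have "1-lipschitz_on UNIV R"
  proof (rule lipschitz_onI)
    fix x y show "dist (R x) (R y) \<le> 1 * dist x y"
      using R_le[of x y] R_le[of y x] by (simp add: dist_real_def dist_commute abs_le_iff)
  qed simp
  then have "continuous_on UNIV R" by (rule lipschitz_on_continuous_on)
  then have "continuous_on UNIV (\<lambda>x. R x / 3)" by (intro continuous_intros) auto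
  moreover have "R x / 3 > 0" for x using R_pos by simp
  moreover have "\<exists>r>0. Q x r \<and> (\<forall>y\<in>ball x r. R y / 3 \<le> r)" for x
  proof -
    \<comment> \<open>An admissible \<open>r > R x / 2\<close> exists, and on
      \<open>ball x r\<close> the Lipschitz bound gives \<open>R y \<le> R x + r < 3 * r\<close>;
      this is where the factor 3 comes from.\<close>
    have "R x / 2 < Sup (S x)" using R_pos[of x] by (simp add: R_def[symmetric])
    then obtain r where r: "r \<in> S x" "R x / 2 < r"
      using less_cSup_iff[OF S_ne bdd] by blast
    have "R y / 3 \<le> r" if "y \<in> ball x r" for y
      using that R_le[of y x] r(2) by (simp add: dist_commute)
    with r show ?thesis by (auto simp: S_def)
  qed
  ultimately show ?thesis by blast
qed

lemma set_plus_ball_mono: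
  assumes "0 \<le> s" "s \<le> r"
  shows "set_plus_ball A s \<subseteq> set_plus_ball A r"
proof
  fix x assume "x \<in> set_plus_ball A s"
  then obtain a u where x: "x = a + s *\<^sub>R u" "a \<in> A" "norm u \<le> 1"
    by (auto simp: set_plus_ball_def)
  show "x \<in> set_plus_ball A r"
  proof (cases "r = 0")
    case True
    with x assms show ?thesis by (auto simp: set_plus_ball_def)
  next
    case False
    then have "x = a + r *\<^sub>R ((s / r) *\<^sub>R u)" using x by simp
    moreover have "s / r * norm u \<le> 1 * 1"
      using assms False x by (intro mult_mono) auto
    ultimately show ?thesis
      unfolding set_plus_ball_def using x(2) assms by (intro CollectI exI[of _ a] exI[of _ "(s / r) *\<^sub>R u"]) auto
  qed
qed

section \<open>Locally Lipschitz functions and their gradients\<close>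

lemma loc_lipschitz_cball:
  fixes x :: "'a::heine_borel"
  assumes "loc_lipschitz B" "r \<ge> 0"
  obtains L where "L-lipschitz_on (cball x r) B"
proof -
  have "cball x r \<noteq> {}" using assms(2) by simp
  then show thesis using assms(1) that unfolding loc_lipschitz_def by (meson compact_cball)
qed

lemma loc_lipschitz_continuous_on:
  fixes B :: "'a::heine_borel \<Rightarrow> 'b::metric_space"
  assumes "loc_lipschitz B"
  shows "continuous_on UNIV B"
proof -
  have "isCont B x" for x
  proof -
    obtain L where "L-lipschitz_on (cball x 1) B"
      using loc_lipschitz_cball[OF assms, of 1 x] by auto
    then have "continuous_on (ball x 1) B"
      by (meson ball_subset_cball continuous_on_subset lipschitz_on_continuous_on)
    then show ?thesis
      by (simp add: continuous_on_eq_continuous_at)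
  qed
  then show ?thesis by (simp add: continuous_at_imp_continuous_on)
qed

text \<open>A small step along the gradient itself raises \<open>f\<close> at a rate close to the
  norm of the gradient, and a Lipschitz function cannot grow faster than \<open>L\<close>.\<close>

lemma norm_gradient_le:
  fixes f :: "'a::euclidean_space \<Rightarrow> real"
  assumes f: "L-lipschitz_on S f" and S: "open S" "z \<in> S" and diff: "f differentiable (at z)"
  shows "norm (gradient f z) \<le> L"
proof (cases "gradient f z = 0")
  case True
  then show ?thesis using lipschitz_on_nonneg[OF f] by simp
next
  case False
  define D where "D = gradient f z"
  have D: "norm D > 0" using False by (simp add: D_def)
  obtain b where b: "b > 0" "ball z b \<subseteq> S" using S by (meson openE)
  show ?thesis unfolding D_def[symmetric]
  proof (rule field_le_epsilon)
    fix e :: real assume e: "e > 0"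
    have "(f has_derivative (\<lambda>h. h \<bullet> D)) (at z)"
      using GDERIV_gradient[OF diff] by (simp add: gderiv_def D_def)
    with e obtain d where d: "d > 0" "\<And>y. norm (y - z) < d \<Longrightarrow> norm (f y - f z - (y - z) \<bullet> D) \<le> e * norm (y - z)"
      unfolding has_derivative_at_alt by meson
    define t where "t = min b d / 2"
    have t: "t > 0" "t < b" "t < d" using b d by (auto simp: t_def)
    define y where "y = z + (t / norm D) *\<^sub>R D"
    have n: "norm (y - z) = t" using t D by (simp add: y_def)
    then have "y \<in> S" using b t by (auto simp: dist_norm norm_minus_commute subset_iff)
    then have "\<bar>f y - f z\<bar> \<le> L * t"
      using lipschitz_onD[OF f, of y z] S n by (simp add: dist_norm)
    moreover have "\<bar>f y - f z - (y - z) \<bullet> D\<bar> \<le> e * t"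
      using d(2)[of y] n t by simp
    moreover have "(y - z) \<bullet> D = t * norm D"
      using D by (simp add: y_def dot_square_norm power2_eq_square)
    ultimately have "t * norm D \<le> L * t + e * t" by linarith
    also have "\<dots> = t * (L + e)" by (simp add: algebra_simps)
    finally show "norm D \<le> L + e" using t by (simp only: mult_le_cancel_left_pos)
  qed
qed

text \<open>The mean value inequality needs a convex domain, so it is used on the convex hull of
  \<open>C\<close>, which is compact and hence carries a bounded gradient.\<close>

lemma continuously_differentiable_loc_lipschitz:
  assumes B: "continuously_differentiable B"
  shows "loc_lipschitz B"
  unfolding loc_lipschitz_def
proof (intro allI impI)
  fix C :: "'a set" assume C: "compact C \<and> C \<noteq> {}"
  let ?H = "convex hull C"
  have "compact (gradient B ` ?H)"
    using B C by (intro compact_continuous_image compact_convex_hull)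
      (auto simp: continuously_differentiable_def intro: continuous_on_subset)
  then obtain M where M: "M > 0" "\<And>x. x \<in> ?H \<Longrightarrow> norm (gradient B x) \<le> M"
    using compact_imp_bounded bounded_pos by (metis imageI)
  have "M-lipschitz_on C B"
  proof (rule lipschitz_onI)
    fix x y assume xy: "x \<in> C" "y \<in> C"
    have "norm (B x - B y) \<le> M * norm (x - y)"
    proof (rule differentiable_bound[where S = ?H and f' = "\<lambda>z h. h \<bullet> gradient B z"])
      fix z assume z: "z \<in> ?H"
      have "GDERIV B z :> gradient B z"
        using B by (intro GDERIV_gradient) (simp add: continuously_differentiable_def)
      then show "(B has_derivative (\<lambda>h. h \<bullet> gradient B z)) (at z within ?H)"
        unfolding gderiv_def by (rule has_derivative_at_withinI)
      show "onorm (\<lambda>h. h \<bullet> gradient B z) \<le> M"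
      proof (rule onorm_le)
        fix h
        have "norm (h \<bullet> gradient B z) \<le> norm h * norm (gradient B z)"
          by (simp add: Cauchy_Schwarz_ineq2)
        also have "\<dots> \<le> norm h * M" using M(2)[OF z] by (rule mult_left_mono) simp
        finally show "norm (h \<bullet> gradient B z) \<le> M * norm h" by (simp add: mult.commute)
      qed
    qed (use xy in \<open>auto intro: hull_inc\<close>)
    then show "dist (B x) (B y) \<le> M * dist x y" by (simp add: dist_norm)
  qed (use M in simp)
  then show "\<exists>L. L-lipschitz_on C B" ..
qed

text \<open>Continuity of the gradient leaves only one possible limit. This is an inclusion because
  \<open>\<Omega>\<close> is arbitrary here and may leave no admissible sequence.\<close>

lemma clarke_gradient_continuously_differentiable:
  assumes B: "continuously_differentiable B"
  shows "clarke_gradient \<Omega> B x \<subseteq> {gradient B x}"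
  unfolding clarke_gradient_def
proof (rule hull_minimal)
  have "isCont (gradient B) x"
    using B by (auto simp: continuously_differentiable_def continuous_on_eq_continuous_at)
  then show "{l. \<exists>s. s \<longlonglongrightarrow> x \<and> (\<forall>i. s i \<notin> \<Omega> \<union> {y. \<not> B differentiable (at y)}) \<and>
      (\<lambda>i. gradient B (s i)) \<longlonglongrightarrow> l} \<subseteq> {gradient B x}"
    by (auto dest: isCont_tendsto_compose intro: LIMSEQ_unique)
qed simp

text \<open>Violations at the scales \<open>1 / (i + 1)\<close> would, by compactness, have limits
  \<open>\<eta>' \<in> F x\<close> and \<open>\<zeta>\<close> in the Clarke gradient with a
  nonnegative inner product.\<close>

lemma uniform_descent_near:
  fixes F :: "'a::euclidean_space \<Rightarrow> 'a set"
  assumes usc: "upper_semicontinuous_map F" and Fx: "F x \<noteq> {}" "compact (F x)"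
    and B: "loc_lipschitz B"
    and descent: "\<And>\<eta> \<zeta>. \<eta> \<in> F x \<Longrightarrow> \<zeta> \<in> clarke_gradient \<Omega> B x \<Longrightarrow> \<zeta> \<bullet> \<eta> < 0"
  shows "\<exists>r>0. \<forall>y\<in>ball x r. \<forall>z\<in>ball x r. \<forall>\<eta>\<in>set_plus_ball (F y) r.
     z \<notin> \<Omega> \<longrightarrow> B differentiable (at z) \<longrightarrow> gradient B z \<bullet> \<eta> \<le> 0"
proof (rule ccontr)
  assume neg: "\<not> ?thesis"
  have "\<exists>y z \<eta>. y \<in> ball x r \<and> z \<in> ball x r \<and> \<eta> \<in> set_plus_ball (F y) r \<and> z \<notin> \<Omega> \<and>
      B differentiable (at z) \<and> gradient B z \<bullet> \<eta> > 0" if "r > 0" for r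
    using neg that by (meson not_le)
  then have "\<exists>y z \<eta>. y \<in> ball x (1 / real (Suc i)) \<and> z \<in> ball x (1 / real (Suc i)) \<and>
      \<eta> \<in> set_plus_ball (F y) (1 / real (Suc i)) \<and> z \<notin> \<Omega> \<and>
      B differentiable (at z) \<and> gradient B z \<bullet> \<eta> > 0" for i
    by simp
  then obtain y z \<eta> where y: "\<And>i. y i \<in> ball x (1 / real (Suc i))"
    and z: "\<And>i. z i \<in> ball x (1 / real (Suc i))"
    and \<eta>: "\<And>i. \<eta> i \<in> set_plus_ball (F (y i)) (1 / real (Suc i))"
    and z': "\<And>i. z i \<notin> \<Omega>" "\<And>i. B differentiable (at (z i))"
    and pos: "\<And>i. gradient B (z i) \<bullet> \<eta> i > 0"
    by metis
  have lim: "s \<longlonglongrightarrow> x" if "\<And>i. s i \<in> ball x (1 / real (Suc i))" for s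
  proof (rule metric_tendsto_imp_tendsto[OF LIMSEQ_inverse_real_of_nat])
    show "\<forall>\<^sub>F i in sequentially. dist (s i) x \<le> dist (inverse (real (Suc i))) 0"
      using that by (intro always_eventually allI) (simp add: dist_commute inverse_eq_divide less_imp_le)
  qed
  \<comment> \<open>Upper semicontinuity brings \<open>\<eta> i\<close> close to the compact set
    \<open>F x\<close>; the nearest points \<open>c i\<close> there have a convergent
    subsequence.\<close>
  define c where "c i = closest_point (F x) (\<eta> i)" for i
  have c: "c i \<in> F x" for i
    unfolding c_def using Fx by (intro closest_point_in_set compact_imp_closed)
  have "(\<lambda>i. \<eta> i - c i) \<longlonglongrightarrow> 0"
  proof (rule LIMSEQ_I)
    fix e :: real assume e: "e > 0"
    have "e / 4 > 0" using e by simp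
    then obtain U where U: "open U" "x \<in> U" "\<And>y. y \<in> U \<Longrightarrow> F y \<subseteq> set_plus_ball (F x) (e / 4)"
      using usc unfolding upper_semicontinuous_map_def by meson
    have "\<forall>\<^sub>F i in sequentially. y i \<in> U"
      using lim[OF y] U(1,2) by (rule topological_tendstoD)
    moreover have "\<forall>\<^sub>F i in sequentially. inverse (real (Suc i)) < e / 4"
      using e by (intro order_tendstoD[OF LIMSEQ_inverse_real_of_nat]) simp
    ultimately have "\<forall>\<^sub>F i in sequentially. norm (\<eta> i - c i - 0) < e"
    proof eventually_elim
      fix i assume i: "y i \<in> U" "inverse (real (Suc i)) < e / 4"
      obtain a u where a: "\<eta> i = a + (1 / real (Suc i)) *\<^sub>R u" "a \<in> F (y i)" "norm u \<le> 1"
        using \<eta>[of i] by (auto simp: set_plus_ball_def)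
      obtain b v where b: "a = b + (e / 4) *\<^sub>R v" "b \<in> F x" "norm v \<le> 1"
        using U(3)[OF i(1)] a(2) by (auto simp: set_plus_ball_def)
      have "dist (\<eta> i) (c i) \<le> dist (\<eta> i) b"
        unfolding c_def using Fx b(2) by (intro closest_point_le compact_imp_closed)
      also have "\<dots> = norm ((e / 4) *\<^sub>R v + (1 / real (Suc i)) *\<^sub>R u)"
        using a(1) b(1) by (simp add: dist_norm)
      also have "\<dots> \<le> norm ((e / 4) *\<^sub>R v) + norm ((1 / real (Suc i)) *\<^sub>R u)"
        by (rule norm_triangle_ineq)
      also have "\<dots> \<le> e / 4 * 1 + (1 / real (Suc i)) * 1"
        unfolding norm_scaleR using a b e by (intro add_mono mult_mono) auto
      also have "\<dots> < e" using i e by (simp add: inverse_eq_divide)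
      finally show "norm (\<eta> i - c i - 0) < e" by (simp add: dist_norm)
    qed
    then show "\<exists>no. \<forall>n\<ge>no. norm (\<eta> n - c n - 0) < e"
      by (simp add: eventually_sequentially)
  qed
  note diff = this
  \<comment> \<open>The Lipschitz constant on the unit ball bounds the gradients, so they stay in a
    compact set too.\<close>
  obtain L where L: "L-lipschitz_on (cball x 1) B"
    using loc_lipschitz_cball[OF B, of 1 x] by auto
  have grad: "gradient B (z i) \<in> cball 0 L" for i
  proof -
    have "1 / real (Suc i) \<le> 1" by simp
    then have "z i \<in> ball x 1" using z[of i] by (meson subset_ball subsetD)
    then have "norm (gradient B (z i)) \<le> L"
      using z'(2) by (intro norm_gradient_le[OF lipschitz_on_subset[OF L ball_subset_cball]]) auto
    then show ?thesis by simp
  qed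
  have "compact (F x \<times> cball (0::'a) L)" using Fx by (intro compact_Times) auto
  moreover have "\<forall>i. (c i, gradient B (z i)) \<in> F x \<times> cball 0 L" using c grad by simp
  ultimately obtain p \<sigma> where p: "p \<in> F x \<times> cball (0::'a) L" "strict_mono (\<sigma> :: nat \<Rightarrow> nat)"
    "((\<lambda>i. (c i, gradient B (z i))) \<circ> \<sigma>) \<longlonglongrightarrow> p"
    unfolding compact_eq_seq_compact_metric by (rule seq_compactE)
  obtain \<eta>' \<zeta> where p': "p = (\<eta>', \<zeta>)" by (cases p)
  have lims: "(\<lambda>i. c (\<sigma> i)) \<longlonglongrightarrow> \<eta>'" "(\<lambda>i. gradient B (z (\<sigma> i))) \<longlonglongrightarrow> \<zeta>"
    using tendsto_fst[OF p(3)] tendsto_snd[OF p(3)] by (simp_all add: p' o_def)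
  have "(\<lambda>i. z (\<sigma> i)) \<longlonglongrightarrow> x"
    using LIMSEQ_subseq_LIMSEQ[OF lim[OF z] p(2)] by (simp add: o_def)
  then have "\<zeta> \<in> clarke_gradient \<Omega> B x"
    unfolding clarke_gradient_def using lims(2) z'
    by (intro hull_inc CollectI exI[of _ "\<lambda>i. z (\<sigma> i)"]) auto
  moreover have "\<eta>' \<in> F x" using p p' by simp
  ultimately have "\<zeta> \<bullet> \<eta>' < 0" by (intro descent)
  moreover have "(\<lambda>i. \<eta> (\<sigma> i)) \<longlonglongrightarrow> \<eta>'"
    using tendsto_add[OF lims(1) LIMSEQ_subseq_LIMSEQ[OF diff p(2)]] by (simp add: o_def)
  then have "(\<lambda>i. gradient B (z (\<sigma> i)) \<bullet> \<eta> (\<sigma> i)) \<longlonglongrightarrow> \<zeta> \<bullet> \<eta>'"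
    using lims(2) by (intro tendsto_inner)
  then have "0 \<le> \<zeta> \<bullet> \<eta>'"
    using pos by (intro LIMSEQ_le_const) (auto intro: less_imp_le)
  ultimately show False by simp
qed

section \<open>Forward invariance under a state-dependent perturbation\<close>

text \<open>A solution that leaves \<open>K\<close> has a last time \<open>t0\<close> in
  \<open>K\<close> before the outside point, and there it is on the frontier. Shortly afterwards it
  is still in the ball where admissible velocities do not increase \<open>B\<close>, so
  \<open>B\<close> cannot have become positive.\<close>

lemma forward_invariant_perturbed:
  fixes F :: "'a::euclidean_space \<Rightarrow> 'a set"
  assumes B: "loc_lipschitz B" and \<Omega>: "\<Omega> \<in> null_sets lebesgue"
    and K: "K = {x. B x \<le> 0}" and \<epsilon>: "\<And>x. \<epsilon> x \<ge> 0"
    and descent: "\<And>x. x \<in> frontier K \<Longrightarrow> \<exists>r>0. (\<forall>y\<in>ball x r. \<epsilon> y \<le> r) \<and>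
      (\<forall>y\<in>ball x r. \<forall>z\<in>ball x r. \<forall>\<eta>\<in>set_plus_ball (F y) r.
         z \<notin> \<Omega> \<longrightarrow> B differentiable (at z) \<longrightarrow> gradient B z \<bullet> \<eta> \<le> 0)"
  shows "forward_invariant (perturbed F \<epsilon>) K"
  unfolding forward_invariant_def
proof (intro ballI allI impI subsetI, elim imageE)
  fix x0 D \<phi> x t1
  assume x0: "x0 \<in> K" and sol: "di_solution (perturbed F \<epsilon>) x0 D \<phi>" and t1: "t1 \<in> D" and "x = \<phi> t1"
  have contB: "continuous_on UNIV B" using B by (rule loc_lipschitz_continuous_on)
  have D: "{0..t1} \<subseteq> D" "0 \<le> t1"
    using sol t1 by (auto simp: di_solution_def solution_domain_def)
  then have ac: "absolutely_continuous_on_interval 0 t1 \<phi>"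
    using sol by (auto simp: di_solution_def locally_absolutely_continuous_on_def)
  then have cont: "continuous_on {0..t1} \<phi>" by (rule absolutely_continuous_imp_continuous_on)
  then have contB\<phi>: "continuous_on {0..t1} (\<lambda>t. B (\<phi> t))"
    by (rule continuous_on_compose2[OF contB]) simp
  have "B (\<phi> t1) \<le> 0"
  proof (rule ccontr)
    assume out: "\<not> B (\<phi> t1) \<le> 0"
    define T where "T = {0..t1} \<inter> (\<lambda>t. B (\<phi> t)) -` {..0}"
    have "compact T"
      unfolding T_def compact_eq_bounded_closed
      by (intro conjI bounded_Int continuous_closed_preimage[OF contB\<phi>]) auto
    moreover have "0 \<in> T" using x0 sol D K by (auto simp: T_def di_solution_def)
    ultimately obtain t0 where t0: "t0 \<in> T" "\<And>t. t \<in> T \<Longrightarrow> t \<le> t0"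
      using compact_attains_sup[of T] by blast
    have "t0 \<noteq> t1" using out t0 by (auto simp: T_def)
    then have t01: "0 \<le> t0" "t0 < t1" "B (\<phi> t0) \<le> 0" using t0 by (auto simp: T_def)
    have after: "B (\<phi> t) > 0" if "t0 < t" "t \<le> t1" for t
      using t0(2)[of t] that t01 by (force simp: T_def)
    have near: "\<exists>d>0. \<forall>t. t0 \<le> t \<longrightarrow> t \<le> t1 \<longrightarrow> t - t0 < d \<longrightarrow> \<phi> t \<in> S"
      if S: "open S" "\<phi> t0 \<in> S" for S
    proof -
      obtain b where b: "b > 0" "ball (\<phi> t0) b \<subseteq> S" using S by (meson openE)
      then obtain d where "d > 0" "\<And>t. t \<in> {0..t1} \<Longrightarrow> dist t t0 < d \<Longrightarrow> dist (\<phi> t) (\<phi> t0) < b"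
        using cont t01 unfolding continuous_on_iff by (metis atLeastAtMost_iff less_imp_le)
      then show ?thesis
        using b t01 by (intro exI[of _ d]) (auto simp: dist_real_def dist_commute subset_iff)
    qed
    \<comment> \<open>From an interior point the solution would stay in \<open>K\<close> a little
      longer, against the choice of \<open>t0\<close>.\<close>
    have "\<phi> t0 \<notin> interior K"
    proof
      assume "\<phi> t0 \<in> interior K"
      with near[OF open_interior] obtain d where d: "d > 0"
        "\<And>t. t0 \<le> t \<Longrightarrow> t \<le> t1 \<Longrightarrow> t - t0 < d \<Longrightarrow> \<phi> t \<in> interior K" by blast
      have "\<phi> (min t1 (t0 + d / 2)) \<in> interior K"
        by (rule d(2)) (use d(1) t01 in auto)
      then have "\<phi> (min t1 (t0 + d / 2)) \<in> K"
        using interior_subset by blast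
      then show False
        using after[of "min t1 (t0 + d / 2)"] d(1) t01 K by auto
    qed
    moreover have "\<phi> t0 \<in> K" using t01 K by simp
    ultimately have "\<phi> t0 \<in> frontier K"
      using closure_subset by (auto simp: frontier_def)
    from descent[OF this] obtain r where r: "r > 0" "\<And>y. y \<in> ball (\<phi> t0) r \<Longrightarrow> \<epsilon> y \<le> r"
      and desc: "\<And>y z \<eta>. y \<in> ball (\<phi> t0) r \<Longrightarrow> z \<in> ball (\<phi> t0) r \<Longrightarrow> \<eta> \<in> set_plus_ball (F y) r \<Longrightarrow>
         z \<notin> \<Omega> \<Longrightarrow> B differentiable (at z) \<Longrightarrow> gradient B z \<bullet> \<eta> \<le> 0" by blast
    have "\<phi> t0 \<in> ball (\<phi> t0) r" using r by simp
    from near[OF open_ball this] obtain d where d: "d > 0"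
      "\<And>t. t0 \<le> t \<Longrightarrow> t \<le> t1 \<Longrightarrow> t - t0 < d \<Longrightarrow> \<phi> t \<in> ball (\<phi> t0) r" by blast
    define t2 where "t2 = min t1 (t0 + d / 2)"
    have t2: "t0 < t2" "t2 \<le> t1" using d(1) t01 by (auto simp: t2_def)
    have inball: "\<phi> t \<in> ball (\<phi> t0) r" if "t \<in> {t0..t2}" for t
      using that t2 d by (intro d(2)) (auto simp: t2_def)
    obtain L where L: "L-lipschitz_on (cball (\<phi> t0) r) B"
      using loc_lipschitz_cball[OF B, of r "\<phi> t0"] r by auto
    have L0: "L \<ge> 0" using L by (rule lipschitz_on_nonneg)
    have "AE t in lebesgue. t \<in> D \<longrightarrow> (\<exists>w\<in>perturbed F \<epsilon> (\<phi> t). (\<phi> has_vector_derivative w) (at t within D))"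
      using sol by (simp add: di_solution_def)
    then obtain N where N: "N \<in> null_sets lebesgue" "\<And>t. t \<notin> N \<Longrightarrow> t \<in> D \<Longrightarrow>
        \<exists>w\<in>perturbed F \<epsilon> (\<phi> t). (\<phi> has_vector_derivative w) (at t within D)"
      by (elim AE_E3) auto
    have "B (\<phi> t2) \<le> B (\<phi> t0)"
    proof (rule absolutely_continuous_nonincreasing[where g = "\<lambda>t. B (\<phi> t)" and a = t0 and b = t2, OF _ _ N(1)])
      show "absolutely_continuous_on_interval t0 t2 (\<lambda>t. B (\<phi> t))"
      proof (rule absolutely_continuous_compose_lipschitz[where \<phi> = \<phi>, OF _ L])
        show "absolutely_continuous_on_interval t0 t2 \<phi>"
          using ac t01 t2 by (intro absolutely_continuous_on_interval_subset[OF ac]) auto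
        show "\<phi> ` {t0..t2} \<subseteq> cball (\<phi> t0) r"
          using inball ball_subset_cball by blast
      qed
      fix t e :: real assume t: "t \<in> {t0..t2}" "t \<notin> N" and e: "e > 0"
      have tD: "{t0..t2} \<subseteq> D" using D t01 t2 by auto
      then have "t \<in> D" using t(1) by blast
      from N(2)[OF t(2) this] obtain w where w: "w \<in> set_plus_ball (F (\<phi> t)) (\<epsilon> (\<phi> t))"
        "(\<phi> has_vector_derivative w) (at t within D)" by (auto simp: perturbed_def)
      have wr: "w \<in> set_plus_ball (F (\<phi> t)) r"
        using w(1) set_plus_ball_mono[OF \<epsilon> r(2)[OF inball[OF t(1)]]] by blast
      \<comment> \<open>With the velocity \<open>w\<close> at time \<open>t\<close> frozen, the
        gradient condition holds for \<open>w\<close> throughout the ball, and descent along one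
        direction applies.\<close>
      have down: "B (y + s *\<^sub>R w) \<le> B y"
        if "y \<in> ball (\<phi> t0) r" "y + s *\<^sub>R w \<in> ball (\<phi> t0) r" "s \<ge> 0" for y s
        by (rule nonincreasing_along_direction[OF r(1) L \<Omega> desc[OF inball[OF t(1)] _ wr] that])
      obtain b where b: "b > 0" "ball (\<phi> t) b \<subseteq> ball (\<phi> t0) r"
        using inball[OF t(1)] by (meson open_ball openE)
      \<comment> \<open>\<open>L\<close> will multiply the first-order error of
        \<open>\<phi>\<close>, hence the division.\<close>
      define e' where "e' = e / (L + 1)"
      have e': "e' > 0" "L * e' \<le> e" using e L0 by (auto simp: e'_def field_simps)
      have "(\<phi> has_derivative (\<lambda>h. h *\<^sub>R w)) (at t within {t0..t2})"
        using has_vector_derivative_within_subset[OF w(2) tD] by (simp add: has_vector_derivative_def)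
      with e'(1) obtain d1 where d1: "d1 > 0" "\<And>s. s \<in> {t0..t2} \<Longrightarrow> \<bar>s - t\<bar> < d1 \<Longrightarrow>
          norm (\<phi> s - \<phi> t - (s - t) *\<^sub>R w) \<le> e' * \<bar>s - t\<bar>"
        unfolding has_derivative_within_alt by (metis real_norm_def)
      \<comment> \<open>The second bound keeps the tangent line within \<open>b\<close> of
        \<open>\<phi> t\<close>, hence in the ball of radius \<open>r\<close>;
        \<open>norm w + 1\<close> allows \<open>w = 0\<close>.\<close>
      define d2 where "d2 = min d1 (b / (norm w + 1))"
      have d2: "d2 > 0" "d2 \<le> d1"
        using d1(1) b(1) by (auto simp: d2_def add_nonneg_pos)
      have d2w: "d2 * norm w < b"
      proof -
        have "d2 * (norm w + 1) \<le> b / (norm w + 1) * (norm w + 1)"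
          by (intro mult_right_mono) (auto simp: d2_def)
        also have "\<dots> = b"
          by (simp add: add_nonneg_eq_0_iff)
        finally show ?thesis
          using d2(1) by (simp add: distrib_left)
      qed
      \<comment> \<open>The solution is replaced by its tangent line at \<open>t\<close>, where
        \<open>down\<close> applies, at a cost of \<open>e\<close> per unit of time in
        \<open>B\<close>.\<close>
      have line: "\<phi> t + (s - t) *\<^sub>R w \<in> ball (\<phi> t0) r \<and> \<bar>B (\<phi> s) - B (\<phi> t + (s - t) *\<^sub>R w)\<bar> \<le> e * \<bar>s - t\<bar>"
        if s: "s \<in> {t0..t2}" "\<bar>s - t\<bar> < d2" for s
      proof -
        have "\<bar>s - t\<bar> * norm w \<le> d2 * norm w"
          using s by (intro mult_right_mono) auto
        then have "\<phi> t + (s - t) *\<^sub>R w \<in> ball (\<phi> t) b"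
          using d2w by (simp add: dist_norm)
        then have in_r: "\<phi> t + (s - t) *\<^sub>R w \<in> ball (\<phi> t0) r" using b by blast
        have "\<bar>B (\<phi> s) - B (\<phi> t + (s - t) *\<^sub>R w)\<bar> \<le> L * norm (\<phi> s - \<phi> t - (s - t) *\<^sub>R w)"
          using lipschitz_onD[OF L, of "\<phi> s" "\<phi> t + (s - t) *\<^sub>R w"] in_r inball[OF s(1)]
          by (simp add: dist_norm algebra_simps)
        also have "\<dots> \<le> L * (e' * \<bar>s - t\<bar>)"
          using d1(2)[OF s(1)] s(2) d2(2) L0 by (intro mult_left_mono) auto
        also have "\<dots> \<le> e * \<bar>s - t\<bar>"
          using mult_right_mono[OF e'(2), of "\<bar>s - t\<bar>"] by (simp add: mult.assoc)
        finally show ?thesis using in_r by blast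
      qed
      show "\<exists>d>0. \<forall>u v. t0 \<le> u \<and> u \<le> t \<and> t \<le> v \<and> v \<le> t2 \<and> v - u < d \<longrightarrow>
          B (\<phi> v) - B (\<phi> u) \<le> e * (v - u)"
      proof (intro exI[of _ d2] conjI allI impI d2(1))
        fix u v assume uv: "t0 \<le> u \<and> u \<le> t \<and> t \<le> v \<and> v \<le> t2 \<and> v - u < d2"
        note u = line[of u] and v = line[of v]
        have "B (\<phi> v) - B (\<phi> t + (v - t) *\<^sub>R w) \<le> e * (v - t)"
          "B (\<phi> t + (u - t) *\<^sub>R w) - B (\<phi> u) \<le> e * (t - u)"
          using u v uv by auto
        moreover have "B (\<phi> t + (v - t) *\<^sub>R w) \<le> B (\<phi> t)"
          using v uv inball[OF t(1)] by (intro down) auto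
        \<comment> \<open>The tangent point at \<open>u\<close> lies behind \<open>\<phi> t\<close>:
          moving on from it for time \<open>t - u\<close> arrives at \<open>\<phi> t\<close>, so
          \<open>down\<close> is again used forwards.\<close>
        moreover have "B (\<phi> t + (u - t) *\<^sub>R w + (t - u) *\<^sub>R w) \<le> B (\<phi> t + (u - t) *\<^sub>R w)"
          using u uv inball[OF t(1)] by (intro down) (auto simp: algebra_simps)
        then have "B (\<phi> t) \<le> B (\<phi> t + (u - t) *\<^sub>R w)"
          by (simp add: algebra_simps)
        ultimately show "B (\<phi> v) - B (\<phi> u) \<le> e * (v - u)"
          by (simp add: right_diff_distrib)
      qed
    qed (use t2 in simp)
    with after[of t2] t2 t01 show False by simp
  qed
  then show "x \<in> K" using K \<open>x = \<phi> t1\<close> by simp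
qed

text \<open>Local descent radii at the frontier are glued into one continuous perturbation of the
  whole space.\<close>

lemma exists_invariant_perturbation:
  fixes F :: "'a::euclidean_space \<Rightarrow> 'a set"
  assumes usc: "upper_semicontinuous_map F" and F: "\<And>x. F x \<noteq> {}" "\<And>x. compact (F x)"
    and B: "loc_lipschitz B" and \<Omega>: "\<Omega> \<in> null_sets lebesgue" and K: "K = {x. B x \<le> 0}"
    and descent: "\<forall>x\<in>frontier K. \<forall>\<eta>\<in>F x. \<forall>\<zeta>\<in>clarke_gradient \<Omega> B x. \<zeta> \<bullet> \<eta> < 0"
  shows "\<exists>\<epsilon>. continuous_on UNIV \<epsilon> \<and> (\<forall>x. \<epsilon> x > 0) \<and> forward_invariant (perturbed F \<epsilon>) K"
proof -
  define P where "P x r \<longleftrightarrow> (\<forall>y\<in>ball x r. \<forall>z\<in>ball x r. \<forall>\<eta>\<in>set_plus_ball (F y) r.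
     z \<notin> \<Omega> \<longrightarrow> B differentiable (at z) \<longrightarrow> gradient B z \<bullet> \<eta> \<le> 0)" for x r
  \<comment> \<open>Balls that miss the frontier count as admissible, so every centre has a radius
    and the property passes to smaller balls inside.\<close>
  define Q where "Q x r \<longleftrightarrow> ball x r \<inter> frontier K = {} \<or> P x r" for x r
  have ex: "\<exists>r>0. Q x r" for x
  proof (cases "x \<in> frontier K")
    case True
    then show ?thesis
      using uniform_descent_near[OF usc F B, of x \<Omega>] descent unfolding Q_def P_def by blast
  next
    case False
    then have "x \<in> - frontier K" "open (- frontier K)" by auto
    then obtain r where "r > 0" "ball x r \<subseteq> - frontier K" by (meson openE)
    then show ?thesis unfolding Q_def by blast
  qed
  have shrink: "Q y s" if "Q x r" "0 < s" "s + dist x y \<le> r" for x y r s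
  proof -
    have "ball y s \<subseteq> ball x r"
    proof
      fix z assume "z \<in> ball y s"
      then show "z \<in> ball x r"
        using that(3) dist_triangle[of x z y] by simp
    qed
    moreover have "set_plus_ball (F z) s \<subseteq> set_plus_ball (F z) r" for z
      using that zero_le_dist[of x y] by (intro set_plus_ball_mono) linarith+
    ultimately show ?thesis
      using that(1) unfolding Q_def P_def by blast
  qed
  have "\<exists>\<epsilon>. continuous_on UNIV \<epsilon> \<and> (\<forall>x. \<epsilon> x > 0) \<and> (\<forall>x. \<exists>r>0. Q x r \<and> (\<forall>y\<in>ball x r. \<epsilon> y \<le> r))"
  proof (rule continuous_radius_function)
    show "\<exists>r>0. Q x r" for x by (rule ex)
    show "Q y s" if "Q x r" "0 < s" "s + dist x y \<le> r" for x y r s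
      using that by (rule shrink)
  qed
  then obtain \<epsilon> where \<epsilon>: "continuous_on UNIV \<epsilon>" "\<And>x. \<epsilon> x > 0"
    "\<And>x. \<exists>r>0. Q x r \<and> (\<forall>y\<in>ball x r. \<epsilon> y \<le> r)" by blast
  have "forward_invariant (perturbed F \<epsilon>) K"
  proof (rule forward_invariant_perturbed[OF B \<Omega> K])
    fix x assume x: "x \<in> frontier K"
    obtain r where r: "r > 0" "Q x r" "\<forall>y\<in>ball x r. \<epsilon> y \<le> r" using \<epsilon>(3) by blast
    moreover have "x \<in> ball x r" using r by simp
    \<comment> \<open>A ball centred at a frontier point meets the frontier, which leaves only the
      descent alternative of \<open>Q\<close>.\<close>
    ultimately have "P x r" using x unfolding Q_def by blast
    with r show "\<exists>r>0. (\<forall>y\<in>ball x r. \<epsilon> y \<le> r) \<and>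
      (\<forall>y\<in>ball x r. \<forall>z\<in>ball x r. \<forall>\<eta>\<in>set_plus_ball (F y) r.
         z \<notin> \<Omega> \<longrightarrow> B differentiable (at z) \<longrightarrow> gradient B z \<bullet> \<eta> \<le> 0)"
      unfolding P_def by blast
  qed (use \<epsilon>(2) in \<open>auto intro: less_imp_le\<close>)
  with \<epsilon>(1,2) show ?thesis by blast
qed

text \<open>\<open>K\<close> contains \<open>Xo\<close> and misses \<open>Xu\<close>, so the
  perturbation that keeps \<open>K\<close> invariant is itself a robustness margin.\<close>

lemma robustly_safe_if_forward_invariant:
  assumes "barrier_candidate B Xo Xu" "K = {x. B x \<le> 0}"
    and "continuous_on UNIV \<epsilon>" "\<forall>x. \<epsilon> x > 0" "forward_invariant (perturbed F \<epsilon>) K"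
  shows "robustly_safe F Xo Xu"
  unfolding robustly_safe_def safe_wrt_def
proof (intro exI[of _ \<epsilon>] conjI ballI allI impI assms(3) assms(4)[rule_format])
  fix x0 D \<phi> assume "x0 \<in> Xo" "di_solution (perturbed F \<epsilon>) x0 D \<phi>"
  then have "\<phi> ` D \<subseteq> K"
    using assms unfolding forward_invariant_def barrier_candidate_def by blast
  also have "K \<subseteq> - Xu"
    using assms by (force simp: barrier_candidate_def)
  finally show "\<phi> ` D \<subseteq> - Xu" .
qed

theorem theorem1:
  fixes F :: "real ^ 'n \<Rightarrow> (real ^ 'n) set"
    and B :: "real ^ 'n \<Rightarrow> real"
    and Xo Xu K \<Omega> :: "(real ^ 'n) set"
  assumes usc: "upper_semicontinuous_map F"
    and F_values: "\<And>x. F x \<noteq> {} \<and> compact (F x) \<and> convex (F x)"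
    and barrier: "barrier_candidate B Xo Xu"
    and K_def: "K = {x. B x \<le> 0}"
    and \<Omega>_null: "\<Omega> \<in> null_sets lebesgue"
    and conditions:
      "(\<exists>\<epsilon>. continuous_on UNIV \<epsilon> \<and> (\<forall>x. \<epsilon> x > 0) \<and> forward_invariant (perturbed F \<epsilon>) K)
       \<or> (loc_lipschitz B \<and>
          (\<forall>x \<in> frontier K. \<forall>\<eta> \<in> F x. \<forall>\<zeta> \<in> clarke_gradient \<Omega> B x. inner \<zeta> \<eta> < 0))
       \<or> (continuously_differentiable B \<and>
          (\<forall>x \<in> frontier K. \<forall>\<eta> \<in> F x. inner (gradient B x) \<eta> < 0))"
  shows "robustly_safe F Xo Xu"
proof -
  have Fx: "F x \<noteq> {}" "compact (F x)" for x
    using F_values by auto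
  note invariant = exists_invariant_perturbation[OF usc Fx _ \<Omega>_null K_def]
  \<comment> \<open>Each alternative is reduced to the first one.\<close>
  have "\<exists>\<epsilon>. continuous_on UNIV \<epsilon> \<and> (\<forall>x. \<epsilon> x > 0) \<and> forward_invariant (perturbed F \<epsilon>) K"
    using conditions
  proof (elim disjE conjE)
    assume C1: "continuously_differentiable B"
      and "\<forall>x \<in> frontier K. \<forall>\<eta> \<in> F x. inner (gradient B x) \<eta> < 0"
    then have "\<forall>x \<in> frontier K. \<forall>\<eta> \<in> F x. \<forall>\<zeta> \<in> clarke_gradient \<Omega> B x. inner \<zeta> \<eta> < 0"
      using clarke_gradient_continuously_differentiable[OF C1] by blast
    then show ?thesis
      by (rule invariant[OF continuously_differentiable_loc_lipschitz[OF C1]])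
  qed (use invariant in blast)+
  then show ?thesis
    using robustly_safe_if_forward_invariant[OF barrier K_def] by blast
qed

end
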